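(* Consider the singular difference equation (SiDE) $$A_n x(n+2)+B_n x(n+1)+C_n x(n)=f(n)\quad\text{for all } n\ge n_0,$$ with $A_n,B_n,C_n\in\mathbb R^{m,d}$, $f(n)\in\mathbb R^m$, $x(n)\in\mathbb R^d$. Assume that the Constant Rank Assumption (see context) is satisfied in every iteration of the Index Reduction Algorithm (see context) applied to this SiDE, so that the strangeness-index $\mu$ is well-defined. Then the SiDE has the same solution set as a strangeness-free SiDE $$\begin{bmatrix} \hat A_{n,1} & \hat B_{n,1} & \hat C_{n,1} \\ 0 & \hat B_{n,2} & \hat C_{n,2} \\ 0 & 0 & \hat C_{n,3} \\ 0 & 0 & 0 \end{bmatrix} \begin{bmatrix} x(n+2) \\ x(n+1) \\ x(n) \end{bmatrix} = \begin{bmatrix} \hat g_1(n) \\ \hat g_2(n) \\ \hat g_3(n) \\ \hat g_4(n) \end{bmatrix} \quad\text{for all } n\ge n_0,$$ with block rows of sizes $r_2^\mu,r_1^\mu,r_0^\mu,v^\mu$, where the matrix $\begin{bmatrix}\hat A_{n,1}^T&\hat B_{n+1,2}^T&\hat C_{n+2,3}^T\end{bmatrix}^T$ has full row rank for all $n\ge n_0$, and the functions $\hat g_2(n)$ and $\hat g_3(n)$ are formed from the components of (at most) $f(n),f(n+1),\dots,f(n+2\mu)$.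
   Context: **Hidden redundancy.** For $P\in\mathbb R^{p,d}$, $Q\in\mathbb R^{q,d}$, the pair $(P,Q)$ has no hidden redundancy if $\operatorname{rank}\begin{bmatrix} P \\ Q \end{bmatrix}=\operatorname{rank}P+\operatorname{rank}Q$; otherwise it has hidden redundancy. **Condensed form.** For every $n\ge n_0$ there is a nonsingular $P_n\in\mathbb R^{m,m}$ such that $$P_n\begin{bmatrix}A_n&B_n&C_n\end{bmatrix}=\begin{bmatrix} A_{n,1} & B_{n,1} & C_{n,1} \\ 0 & B_{n,2} & C_{n,2} \\ 0 & 0 & C_{n,3} \\ 0 & 0 & 0 \end{bmatrix}$$ with block row sizes $r_{2,n},r_{1,n},r_{0,n},v_n$, and with $A_{n,1},B_{n,2},C_{n,3}$ of full row rank. The right-hand side becomes $P_nf(n)=[f_1(n)^T\ f_2(n)^T\ f_3(n)^T\ f_4(n)^T]^T$. The sizes do not depend on the choice of $P_n$. **Constant Rank Assumption.** The numbers $r_{2,n},r_{1,n},r_{0,n}$ are constant for all $n\ge n_0$ (then denoted $r_2,r_1,r_0$, and $v:=m-r_2-r_1-r_0$), and the matrices $\begin{bmatrix}A_{n,1}^T&B_{n,2}^T&C_{n,3}^T\end{bmatrix}^T$ and $\begin{bmatrix}B_{n,2}^T&C_{n,3}^T\end{bmatrix}^T$ have constant rank for all $n\ge n_0$. **Index reduction step.** For a system in condensed form, choose for each $n$ matrices $S^{(1)}_n,S^{(2)}_n,Z^{(1)}_n,\dots,Z^{(5)}_n$ of compatible sizes such that: $\begin{bmatrix} S^{(i)}_n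 \\ Z^{(i)}_n \end{bmatrix}\in\mathbb R^{r_i,r_i}$ is orthogonal for $i=1,2$; $Z^{(1)}_nB_{n,2}+Z^{(3)}_nC_{n+1,3}=0$; $Z^{(2)}_nA_{n,1}+Z^{(4)}_nB_{n+1,2}+Z^{(5)}_nC_{n+2,3}=0$; $S^{(1)}_nB_{n,2}$ and $S^{(2)}_nA_{n,1}$ have full row rank; and the pairs $(S^{(1)}_nB_{n,2},\,C_{n+1,3})$ and $\left(S^{(2)}_nA_{n,1},\begin{bmatrix} B_{n+1,2} \\ C_{n+2,3} \end{bmatrix}\right)$ have no hidden redundancy. (Such matrices always exist; blocks may be empty.) The step replaces the system by $$\begin{bmatrix} S^{(2)}_nA_{n,1} & S^{(2)}_nB_{n,1} & S^{(2)}_nC_{n,1} \\ 0 & Z^{(2)}_nB_{n,1}+Z^{(4)}_nC_{n+1,2} & Z^{(2)}_nC_{n,1} \\ 0 & S^{(1)}_nB_{n,2} & S^{(1)}_nC_{n,2} \\ 0 & 0 & Z^{(1)}_nC_{n,2} \\ 0 & 0 & C_{n,3} \\ 0 & 0 & 0 \end{bmatrix} \begin{bmatrix} x(n+2) \\ x(n+1) \\ x(n) \end{bmatrix} = \begin{bmatrix} S^{(2)}_n f_1(n) \\ Z^{(2)}_n f_1(n)+Z^{(4)}_n f_2(n+1)+Z^{(5)}_n f_3(n+2) \\ S^{(1)}_n f_2(n) \\ Z^{(1)}_n f_2(n)+Z^{(3)}_n f_3(n+1) \\ f_3(n) \\ f_4(n) \end{bmatrix},\quad n\ge n_0.$$ **Index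 Reduction Algorithm.** Set $i=0$. (a) Bring the current system to condensed form. (b) If for all $n\ge n_0$ both pairs $\left(A_{n,1},\begin{bmatrix} B_{n+1,2} \\ C_{n+2,3} \end{bmatrix}\right)$ and $(B_{n,2},C_{n+1,3})$ have no hidden redundancy, set $\mu=i$ and stop; the block sizes are then denoted $r_2^\mu,r_1^\mu,r_0^\mu,v^\mu$. (c) Otherwise, set $i:=i+1$, perform an index reduction step, and return to (a) with the new system. The number $\mu$ is called the strangeness-index. **Strangeness-free.** A SiDE is strangeness-free if, after scaling with a pointwise nonsingular matrix sequence, it has the block form displayed in the claim with $\begin{bmatrix}\hat A_{n,1}^T&\hat B_{n+1,2}^T&\hat C_{n+2,3}^T\end{bmatrix}^T$ of full row rank for all $n\ge n_0$. *)

theory Defs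
  imports "Jordan_Normal_Form.Matrix" "Jordan_Normal_Form.DL_Rank"
begin

text \<open>
  Block sizes vary with the time step and with the iteration of the algorithm, and blocks may be
  empty, so matrices and vectors are those of Jordan Normal Form, which carry their dimensions as
  data.  Sequences are functions on \<open>nat\<close>; only their values at \<open>n \<ge> n0\<close> matter.
\<close>

definition mrank :: "real mat \<Rightarrow> nat" where
  "mrank M = vec_space.rank (dim_row M) M"

definition full_row_rank :: "real mat \<Rightarrow> bool" where
  "full_row_rank M \<longleftrightarrow> mrank M = dim_row M"

definition nonsingular :: "nat \<Rightarrow> real mat \<Rightarrow> bool" where
  "nonsingular k M \<longleftrightarrow> M \<in> carrier_mat k k \<and> invertible_mat M"

text \<open>Orthonormal rows and columns; the library's \<open>orthogonal_mat\<close> does not normalise.\<close>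

definition orthogonal_matrix_of_size :: "nat \<Rightarrow> real mat \<Rightarrow> bool" where
  "orthogonal_matrix_of_size k Q \<longleftrightarrow>
     Q \<in> carrier_mat k k \<and> Q\<^sup>T * Q = 1\<^sub>m k \<and> Q * Q\<^sup>T = 1\<^sub>m k"

definition no_hidden_redundancy :: "real mat \<Rightarrow> real mat \<Rightarrow> bool" where
  "no_hidden_redundancy P Q \<longleftrightarrow> mrank (P @\<^sub>r Q) = mrank P + mrank Q"


text \<open>
  The equation \<open>coefA n x(n+2) + coefB n x(n+1) + coefC n x(n) = inhom n\<close>.
\<close>

record side =
  coefA :: "nat \<Rightarrow> real mat"
  coefB :: "nat \<Rightarrow> real mat"
  coefC :: "nat \<Rightarrow> real mat"
  inhom :: "nat \<Rightarrow> real vec"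

definition side_dims :: "nat \<Rightarrow> nat \<Rightarrow> nat \<Rightarrow> side \<Rightarrow> bool" where
  "side_dims n0 m d E \<longleftrightarrow> (\<forall>n\<ge>n0.
     coefA E n \<in> carrier_mat m d \<and> coefB E n \<in> carrier_mat m d \<and>
     coefC E n \<in> carrier_mat m d \<and> inhom E n \<in> carrier_vec m)"

definition solution_set :: "nat \<Rightarrow> nat \<Rightarrow> side \<Rightarrow> (nat \<Rightarrow> real vec) set" where
  "solution_set n0 d E = {x. \<forall>n\<ge>n0. x n \<in> carrier_vec d \<and>
     coefA E n *\<^sub>v x (n + 2) + coefB E n *\<^sub>v x (n + 1) + coefC E n *\<^sub>v x n = inhom E n}"

definition scaled_side :: "(nat \<Rightarrow> real mat) \<Rightarrow> side \<Rightarrow> side" where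
  "scaled_side P E = \<lparr>coefA = (\<lambda>n. P n * coefA E n), coefB = (\<lambda>n. P n * coefB E n),
     coefC = (\<lambda>n. P n * coefC E n), inhom = (\<lambda>n. P n *\<^sub>v inhom E n)\<rparr>"

definition same_side :: "nat \<Rightarrow> side \<Rightarrow> side \<Rightarrow> bool" where
  "same_side n0 E F \<longleftrightarrow> (\<forall>n\<ge>n0. coefA E n = coefA F n \<and> coefB E n = coefB F n \<and>
     coefC E n = coefC F n \<and> inhom E n = inhom F n)"


text \<open>
  The nonzero blocks of the staircase form
  \<open>[A1 B1 C1; 0 B2 C2; 0 0 C3; 0 0 0]\<close>.
\<close>

record blocks =
  blkA1 :: "nat \<Rightarrow> real mat"
  blkB1 :: "nat \<Rightarrow> real mat"
  blkC1 :: "nat \<Rightarrow> real mat"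
  blkB2 :: "nat \<Rightarrow> real mat"
  blkC2 :: "nat \<Rightarrow> real mat"
  blkC3 :: "nat \<Rightarrow> real mat"

definition size2 :: "'a blocks_scheme \<Rightarrow> nat \<Rightarrow> nat" where
  "size2 K n = dim_row (blkA1 K n)"

definition size1 :: "'a blocks_scheme \<Rightarrow> nat \<Rightarrow> nat" where
  "size1 K n = dim_row (blkB2 K n)"

definition size0 :: "'a blocks_scheme \<Rightarrow> nat \<Rightarrow> nat" where
  "size0 K n = dim_row (blkC3 K n)"

definition sizev :: "nat \<Rightarrow> 'a blocks_scheme \<Rightarrow> nat \<Rightarrow> nat" where
  "sizev m K n = m - size2 K n - size1 K n - size0 K n"

definition blocks_dims ::
  "nat \<Rightarrow> nat \<Rightarrow> (nat \<Rightarrow> nat) \<Rightarrow> (nat \<Rightarrow> nat) \<Rightarrow> (nat \<Rightarrow> nat) \<Rightarrow> 'a blocks_scheme \<Rightarrow> bool" where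
  "blocks_dims n0 d r2 r1 r0 K \<longleftrightarrow> (\<forall>n\<ge>n0.
     blkA1 K n \<in> carrier_mat (r2 n) d \<and> blkB1 K n \<in> carrier_mat (r2 n) d \<and>
     blkC1 K n \<in> carrier_mat (r2 n) d \<and>
     blkB2 K n \<in> carrier_mat (r1 n) d \<and> blkC2 K n \<in> carrier_mat (r1 n) d \<and>
     blkC3 K n \<in> carrier_mat (r0 n) d)"

definition rhs_dims :: "nat \<Rightarrow> (nat \<Rightarrow> nat) \<Rightarrow> (nat \<Rightarrow> nat) \<Rightarrow> (nat \<Rightarrow> nat) \<Rightarrow> (nat \<Rightarrow> nat) \<Rightarrow>
    (nat \<Rightarrow> real vec) \<Rightarrow> (nat \<Rightarrow> real vec) \<Rightarrow> (nat \<Rightarrow> real vec) \<Rightarrow> (nat \<Rightarrow> real vec) \<Rightarrow> bool" where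
  "rhs_dims n0 r2 r1 r0 v g1 g2 g3 g4 \<longleftrightarrow> (\<forall>n\<ge>n0.
     g1 n \<in> carrier_vec (r2 n) \<and> g2 n \<in> carrier_vec (r1 n) \<and>
     g3 n \<in> carrier_vec (r0 n) \<and> g4 n \<in> carrier_vec (v n))"

definition block_side :: "nat \<Rightarrow> (nat \<Rightarrow> nat) \<Rightarrow> 'a blocks_scheme \<Rightarrow> (nat \<Rightarrow> real vec) \<Rightarrow>
    (nat \<Rightarrow> real vec) \<Rightarrow> (nat \<Rightarrow> real vec) \<Rightarrow> (nat \<Rightarrow> real vec) \<Rightarrow> side" where
  "block_side d v K g1 g2 g3 g4 = \<lparr>
     coefA = (\<lambda>n. blkA1 K n @\<^sub>r 0\<^sub>m (size1 K n) d @\<^sub>r 0\<^sub>m (size0 K n) d @\<^sub>r 0\<^sub>m (v n) d),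
     coefB = (\<lambda>n. blkB1 K n @\<^sub>r blkB2 K n         @\<^sub>r 0\<^sub>m (size0 K n) d @\<^sub>r 0\<^sub>m (v n) d),
     coefC = (\<lambda>n. blkC1 K n @\<^sub>r blkC2 K n         @\<^sub>r blkC3 K n         @\<^sub>r 0\<^sub>m (v n) d),
     inhom = (\<lambda>n. g1 n @\<^sub>v g2 n @\<^sub>v g3 n @\<^sub>v g4 n)\<rparr>"

definition strangeness_free :: "nat \<Rightarrow> nat \<Rightarrow> nat \<Rightarrow> side \<Rightarrow> bool" where
  "strangeness_free n0 m d E \<longleftrightarrow>
     (\<exists>P r2 r1 r0 v (K :: blocks) g1 g2 g3 g4.
        (\<forall>n\<ge>n0. nonsingular m (P n)) \<and>
        blocks_dims n0 d (\<lambda>_. r2) (\<lambda>_. r1) (\<lambda>_. r0) K \<and>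
        rhs_dims n0 (\<lambda>_. r2) (\<lambda>_. r1) (\<lambda>_. r0) (\<lambda>_. v) g1 g2 g3 g4 \<and>
        same_side n0 (scaled_side P E) (block_side d (\<lambda>_. v) K g1 g2 g3 g4) \<and>
        (\<forall>n\<ge>n0. full_row_rank (blkA1 K n @\<^sub>r blkB2 K (n + 1) @\<^sub>r blkC3 K (n + 2))))"


record condensed = blocks +
  scaling :: "nat \<Rightarrow> real mat"
  rhs1 :: "nat \<Rightarrow> real vec"
  rhs2 :: "nat \<Rightarrow> real vec"
  rhs3 :: "nat \<Rightarrow> real vec"
  rhs4 :: "nat \<Rightarrow> real vec"

definition is_condensed_form :: "nat \<Rightarrow> nat \<Rightarrow> nat \<Rightarrow> side \<Rightarrow> condensed \<Rightarrow> bool" where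
  "is_condensed_form n0 m d E K \<longleftrightarrow>
     (\<forall>n\<ge>n0. nonsingular m (scaling K n)) \<and>
     blocks_dims n0 d (size2 K) (size1 K) (size0 K) K \<and>
     rhs_dims n0 (size2 K) (size1 K) (size0 K) (sizev m K) (rhs1 K) (rhs2 K) (rhs3 K) (rhs4 K) \<and>
     same_side n0 (scaled_side (scaling K) E)
       (block_side d (sizev m K) K (rhs1 K) (rhs2 K) (rhs3 K) (rhs4 K)) \<and>
     (\<forall>n\<ge>n0. full_row_rank (blkA1 K n) \<and> full_row_rank (blkB2 K n) \<and> full_row_rank (blkC3 K n))"

definition constant_rank_assumption :: "nat \<Rightarrow> condensed \<Rightarrow> bool" where
  "constant_rank_assumption n0 K \<longleftrightarrow>
     (\<exists>r2 r1 r0. \<forall>n\<ge>n0. size2 K n = r2 \<and> size1 K n = r1 \<and> size0 K n = r0) \<and>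
     (\<exists>r. \<forall>n\<ge>n0. mrank (blkA1 K n @\<^sub>r blkB2 K n @\<^sub>r blkC3 K n) = r) \<and>
     (\<exists>r. \<forall>n\<ge>n0. mrank (blkB2 K n @\<^sub>r blkC3 K n) = r)"

definition stopping_condition :: "nat \<Rightarrow> condensed \<Rightarrow> bool" where
  "stopping_condition n0 K \<longleftrightarrow> (\<forall>n\<ge>n0.
     no_hidden_redundancy (blkA1 K n) (blkB2 K (n + 1) @\<^sub>r blkC3 K (n + 2)) \<and>
     no_hidden_redundancy (blkB2 K n) (blkC3 K (n + 1)))"


record reduction =
  S1 :: "nat \<Rightarrow> real mat"
  S2 :: "nat \<Rightarrow> real mat"
  Z1 :: "nat \<Rightarrow> real mat"
  Z2 :: "nat \<Rightarrow> real mat"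
  Z3 :: "nat \<Rightarrow> real mat"
  Z4 :: "nat \<Rightarrow> real mat"
  Z5 :: "nat \<Rightarrow> real mat"

definition admissible_reduction :: "nat \<Rightarrow> nat \<Rightarrow> condensed \<Rightarrow> reduction \<Rightarrow> bool" where
  "admissible_reduction n0 d K R \<longleftrightarrow> (\<forall>n\<ge>n0.
     S1 R n \<in> carrier_mat (dim_row (S1 R n)) (size1 K n) \<and>
     Z1 R n \<in> carrier_mat (dim_row (Z1 R n)) (size1 K n) \<and>
     Z3 R n \<in> carrier_mat (dim_row (Z1 R n)) (size0 K (n + 1)) \<and>
     S2 R n \<in> carrier_mat (dim_row (S2 R n)) (size2 K n) \<and>
     Z2 R n \<in> carrier_mat (dim_row (Z2 R n)) (size2 K n) \<and>
     Z4 R n \<in> carrier_mat (dim_row (Z2 R n)) (size1 K (n + 1)) \<and>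
     Z5 R n \<in> carrier_mat (dim_row (Z2 R n)) (size0 K (n + 2)) \<and>
     orthogonal_matrix_of_size (size1 K n) (S1 R n @\<^sub>r Z1 R n) \<and>
     orthogonal_matrix_of_size (size2 K n) (S2 R n @\<^sub>r Z2 R n) \<and>
     Z1 R n * blkB2 K n + Z3 R n * blkC3 K (n + 1) = 0\<^sub>m (dim_row (Z1 R n)) d \<and>
     Z2 R n * blkA1 K n + Z4 R n * blkB2 K (n + 1) + Z5 R n * blkC3 K (n + 2)
       = 0\<^sub>m (dim_row (Z2 R n)) d \<and>
     full_row_rank (S1 R n * blkB2 K n) \<and>
     full_row_rank (S2 R n * blkA1 K n) \<and>
     no_hidden_redundancy (S1 R n * blkB2 K n) (blkC3 K (n + 1)) \<and>
     no_hidden_redundancy (S2 R n * blkA1 K n) (blkB2 K (n + 1) @\<^sub>r blkC3 K (n + 2)))"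

definition reduced_side :: "nat \<Rightarrow> nat \<Rightarrow> condensed \<Rightarrow> reduction \<Rightarrow> side" where
  "reduced_side m d K R = \<lparr>
     coefA = (\<lambda>n.
          S2 R n * blkA1 K n
       @\<^sub>r 0\<^sub>m (dim_row (Z2 R n)) d
       @\<^sub>r 0\<^sub>m (dim_row (S1 R n)) d
       @\<^sub>r 0\<^sub>m (dim_row (Z1 R n)) d
       @\<^sub>r 0\<^sub>m (size0 K n) d
       @\<^sub>r 0\<^sub>m (sizev m K n) d),
     coefB = (\<lambda>n.
          S2 R n * blkB1 K n
       @\<^sub>r (Z2 R n * blkB1 K n + Z4 R n * blkC2 K (n + 1))
       @\<^sub>r S1 R n * blkB2 K n
       @\<^sub>r 0\<^sub>m (dim_row (Z1 R n)) d
       @\<^sub>r 0\<^sub>m (size0 K n) d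
       @\<^sub>r 0\<^sub>m (sizev m K n) d),
     coefC = (\<lambda>n.
          S2 R n * blkC1 K n
       @\<^sub>r Z2 R n * blkC1 K n
       @\<^sub>r S1 R n * blkC2 K n
       @\<^sub>r Z1 R n * blkC2 K n
       @\<^sub>r blkC3 K n
       @\<^sub>r 0\<^sub>m (sizev m K n) d),
     inhom = (\<lambda>n.
          S2 R n *\<^sub>v rhs1 K n
       @\<^sub>v (Z2 R n *\<^sub>v rhs1 K n + Z4 R n *\<^sub>v rhs2 K (n + 1) + Z5 R n *\<^sub>v rhs3 K (n + 2))
       @\<^sub>v S1 R n *\<^sub>v rhs2 K n
       @\<^sub>v (Z1 R n *\<^sub>v rhs2 K n + Z3 R n *\<^sub>v rhs3 K (n + 1))
       @\<^sub>v rhs3 K n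
       @\<^sub>v rhs4 K n)\<rparr>"


text \<open>
  The algorithm is nondeterministic: condensed forms and reduction matrices are chosen.  A run
  consists of the systems \<open>sys i\<close>, the condensed forms \<open>K i\<close> and the reductions \<open>R i\<close> of all
  iterations \<open>i\<close> that are reached; the three sequences are unconstrained after the algorithm has
  stopped, and a run may a priori be infinite.
\<close>

definition reached :: "nat \<Rightarrow> (nat \<Rightarrow> condensed) \<Rightarrow> nat \<Rightarrow> bool" where
  "reached n0 K i \<longleftrightarrow> (\<forall>j<i. \<not> stopping_condition n0 (K j))"

definition algorithm_run :: "nat \<Rightarrow> nat \<Rightarrow> nat \<Rightarrow> side \<Rightarrow>
    (nat \<Rightarrow> side) \<Rightarrow> (nat \<Rightarrow> condensed) \<Rightarrow> (nat \<Rightarrow> reduction) \<Rightarrow> bool" where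
  "algorithm_run n0 m d E sys K R \<longleftrightarrow>
     sys 0 = E \<and>
     (\<forall>i. reached n0 K i \<longrightarrow>
        is_condensed_form n0 m d (sys i) (K i) \<and>
        (\<not> stopping_condition n0 (K i) \<longrightarrow>
           admissible_reduction n0 d (K i) (R i) \<and>
           sys (Suc i) = reduced_side m d (K i) (R i)))"

definition is_strangeness_index :: "nat \<Rightarrow> (nat \<Rightarrow> condensed) \<Rightarrow> nat \<Rightarrow> bool" where
  "is_strangeness_index n0 K \<mu> \<longleftrightarrow> reached n0 K \<mu> \<and> stopping_condition n0 (K \<mu>)"


text \<open>
  \<open>g n\<close> is the linear combination of \<open>h n, \<dots>, h (n + N)\<close> with coefficient matrices
  \<open>G n 0, \<dots>, G n N\<close>.  For a single fixed \<open>h\<close> the mere existence of such \<open>G\<close> says little, so \<open>G\<close> is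
  a parameter, to be fixed before \<open>h\<close>.
\<close>

definition formed_from_window :: "nat \<Rightarrow> nat \<Rightarrow> nat \<Rightarrow> nat \<Rightarrow> (nat \<Rightarrow> nat \<Rightarrow> real mat) \<Rightarrow>
    (nat \<Rightarrow> real vec) \<Rightarrow> (nat \<Rightarrow> real vec) \<Rightarrow> bool" where
  "formed_from_window n0 s m N G h g \<longleftrightarrow> (\<forall>n\<ge>n0.
     (\<forall>k\<le>N. G n k \<in> carrier_mat s m) \<and>
     g n = vec s (\<lambda>i. \<Sum>k\<le>N. (G n k *\<^sub>v h (n + k)) $ i))"

end

theory Submission
  imports Defs
begin

text \<open>
  Every reduction step preserves the solution set for each inhomogeneity: the new equations are
  combinations of old equations at times \<open>n\<close>, \<open>n + 1\<close>, \<open>n + 2\<close>, and the old ones are recovered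
  from the bottom row upwards, since \<open>[S1; Z1]\<close> and \<open>[S2; Z2]\<close> are invertible.  A step thus
  widens the window of the inhomogeneity by two.

  For termination, rank bounds give \<open>r2' \<le> dim_row S2\<close> and
  \<open>r2' + r1' \<le> r2 + dim_row S1\<close> for the new sizes \<open>r2', r1'\<close>.  If \<open>(r2, r1)\<close> did not decrease
  lexicographically, \<open>Z1\<close> and \<open>Z2\<close> would therefore be empty at all times, so that \<open>S1\<close> and
  \<open>S2\<close> would be square and there would have been no hidden redundancy to remove.
\<close>

subsection \<open>Rank factorizations\<close>

text \<open>The window coefficients have to be fixed before the inhomogeneity. This is possible
  because coefficient matrices, scalings and reduction matrices never refer to the right-hand side:
  the run is replayed with the same matrices for an arbitrary \<open>h\<close>, and every right-hand
  side that occurs is a linear map of \<open>h\<close>. The delicate size bound is the one on the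
  sum of the two new sizes, because the new blocks \<open>blkA1\<close> and \<open>blkB2\<close>
  stem from two different coefficients. Both coefficients vanish outside the same \<open>S2\<close>,
  \<open>Z2\<close> and \<open>S1\<close> rows, so both factor through one matrix with that many
  columns. Right inverses of the two full-rank blocks then combine the factorizations into one
  identity matrix, whose size cannot exceed the number of these columns.\<close>

lemma (in vec_space) in_span_cols_iff:
  assumes M: "M \<in> carrier_mat n k"
  shows "v \<in> span (set (cols M)) \<longleftrightarrow> (\<exists>c \<in> carrier_vec k. v = M *\<^sub>v c)"
proof -
  have sub: "set (cols M) \<subseteq> carrier_vec n" using M cols_dim by blast
  have M': "mat_of_cols n (cols M) = M" using M mat_of_cols_cols by blast
  have len: "length (cols M) = k" using M by simp
  have *: "lincomb_list c (cols M) = M *\<^sub>v vec k c" for c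
    using lincomb_list_as_mat_mult[of "cols M" c] sub M' len by (metis carrier_vecD subsetD)
  have "v \<in> span (set (cols M)) \<longleftrightarrow> (\<exists>c. v = M *\<^sub>v vec k c)"
    unfolding span_list_as_span[OF sub, symmetric] span_list_def * by blast
  also have "\<dots> \<longleftrightarrow> (\<exists>c \<in> carrier_vec k. v = M *\<^sub>v c)"
  proof
    assume "\<exists>c \<in> carrier_vec k. v = M *\<^sub>v c"
    then obtain c where c: "c \<in> carrier_vec k" "v = M *\<^sub>v c" by blast
    have "vec k (\<lambda>i. c $ i) = c" using c(1) by auto
    then show "\<exists>c. v = M *\<^sub>v vec k c" using c(2) by metis
  next
    assume "\<exists>c. v = M *\<^sub>v vec k c"
    then show "\<exists>c \<in> carrier_vec k. v = M *\<^sub>v c" using vec_carrier by blast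
  qed
  finally show ?thesis .
qed

text \<open>The coefficient vectors are put side by side. This is how statements about spans become
  matrix equations; \<open>w\<close> will be the columns of a matrix to be factored, or the unit
  vectors.\<close>

lemma columnwise_product:
  fixes M :: "'a :: semiring_0 mat"
  assumes M: "M \<in> carrier_mat r k"
    and w: "\<And>j. j < n \<Longrightarrow> \<exists>c \<in> carrier_vec k. w j = M *\<^sub>v c"
  shows "\<exists>N \<in> carrier_mat k n. \<forall>j<n. col (M * N) j = w j"
proof -
  obtain c where c: "\<And>j. j < n \<Longrightarrow> c j \<in> carrier_vec k \<and> w j = M *\<^sub>v c j"
    using w by metis
  define N where "N = mat k n (\<lambda>(i, j). c j $ i)"
  have N: "N \<in> carrier_mat k n" unfolding N_def by simp
  have "col N j = c j" if "j < n" for j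
    using c[OF that] that unfolding N_def by (auto intro!: eq_vecI)
  then have "\<forall>j<n. col (M * N) j = w j" using c col_mult2[OF M N] by simp
  then show ?thesis using N by blast
qed

text \<open>A vector of \<open>S\<close> outside the span could be adjoined to \<open>U\<close>
  without losing independence, against maximality.\<close>

lemma (in vec_space) span_maximal_indpt:
  assumes S: "S \<subseteq> carrier_vec n" and U: "maximal U (\<lambda>T. T \<subseteq> S \<and> lin_indpt T)"
  shows "S \<subseteq> span U"
proof
  fix s assume s: "s \<in> S"
  have US: "U \<subseteq> S" and ind: "lin_indpt U" using U unfolding maximal_def by auto
  have UV: "U \<subseteq> carrier_vec n" using US S by auto
  show "s \<in> span U"
  proof (rule ccontr)
    assume ns: "s \<notin> span U"
    then have "lin_indpt (U \<union> {s})"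
      using lin_dep_iff_in_span[OF UV ind] s S UV span_mem by blast
    then have "U \<union> {s} = U" using U US s unfolding maximal_def by blast
    then show False using ns UV span_mem by blast
  qed
qed

lemma (in vec_space) maximal_indpt_cols:
  assumes "M \<in> carrier_mat n k"
  obtains U where "finite U" "maximal U (\<lambda>T. T \<subseteq> set (cols M) \<and> lin_indpt T)"
    "U \<subseteq> set (cols M)" "lin_indpt U" "card U = rank M" "set (cols M) \<subseteq> span U"
proof -
  have ex: "\<exists>U. finite U \<and> maximal U (\<lambda>T. T \<subseteq> set (cols M) \<and> lin_indpt T) \<and> {} \<subseteq> U"
    by (rule maximal_exists_superset[of "set (cols M)"]) (auto simp: finite_lin_indpt2)
  then obtain U where U: "finite U" "maximal U (\<lambda>T. T \<subseteq> set (cols M) \<and> lin_indpt T)" by blast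
  have sub: "set (cols M) \<subseteq> carrier_vec n" using assms cols_dim by blast
  have m: "U \<subseteq> set (cols M)" "lin_indpt U" using U(2) unfolding maximal_def by blast+
  have "card U = rank M" using rank_card_indpt[OF assms U(2)] by (rule sym)
  then show thesis using that[OF U m] span_maximal_indpt[OF sub U(2)] by blast
qed

text \<open>The columns of \<open>X * Y\<close> lie in the span of the at most \<open>k\<close>
  columns of \<open>X\<close>, and by the exchange lemma no independent set in that span is larger.
  The bounds on block sizes below all rest on this: a size appears as a rank, the competing number
  of rows as an inner dimension.\<close>

lemma (in vec_space) rank_mult_le_inner:
  assumes X: "X \<in> carrier_mat n k" and Y: "Y \<in> carrier_mat k nc"
  shows "rank (X * Y) \<le> k"
proof -
  have XY: "X * Y \<in> carrier_mat n nc" using X Y by auto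
  obtain U where U: "finite U" "U \<subseteq> set (cols (X * Y))" "lin_indpt U" "card U = rank (X * Y)"
    using maximal_indpt_cols[OF XY] by metis
  have "set (cols (X * Y)) \<subseteq> span (set (cols X))"
  proof
    fix v assume "v \<in> set (cols (X * Y))"
    then obtain j where j: "j < nc" "v = col (X * Y) j"
      using XY by (auto simp: cols_def)
    then have "v = X *\<^sub>v col Y j" using col_mult2[OF X Y] by metis
    moreover have "col Y j \<in> carrier_vec k" using Y by auto
    ultimately show "v \<in> span (set (cols X))" using in_span_cols_iff[OF X] by blast
  qed
  then have Us: "U \<subseteq> span (set (cols X))" using U(2) by auto
  have sub: "set (cols X) \<subseteq> carrier_vec n" using X cols_dim by blast
  from replacement[OF U(1) _ _ U(3) Us] sub have "card U \<le> card (set (cols X))" by auto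
  also have "\<dots> \<le> k" using X card_length[of "cols X"] by auto
  finally show ?thesis using U(4) by simp
qed

text \<open>\<open>X\<close> lists a maximal independent set of columns of \<open>M\<close>, and
  \<open>Y\<close> holds the coordinates of every column with respect to it.\<close>

lemma (in vec_space) rank_factorization:
  assumes M: "M \<in> carrier_mat n nc"
  shows "\<exists>X \<in> carrier_mat n (rank M). \<exists>Y \<in> carrier_mat (rank M) nc. M = X * Y"
proof -
  obtain U where U: "finite U" "U \<subseteq> set (cols M)" "card U = rank M" "set (cols M) \<subseteq> span U"
    using maximal_indpt_cols[OF M] by metis
  obtain us where us: "set us = U" "distinct us" using finite_distinct_list[OF U(1)] by blast
  have len: "length us = rank M" using us U(3) distinct_card by force
  define X where "X = mat_of_cols n us"
  have X: "X \<in> carrier_mat n (rank M)" unfolding X_def using len by auto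
  have "U \<subseteq> carrier_vec n" using U(2) M cols_dim by blast
  then have cX: "set (cols X) = U" unfolding X_def using us(1) by simp
  have "\<exists>c \<in> carrier_vec (rank M). col M j = X *\<^sub>v c" if "j < nc" for j
  proof -
    have "col M j \<in> set (cols M)" using M that by (auto simp: cols_def)
    then show ?thesis using U(4) cX in_span_cols_iff[OF X] by auto
  qed
  from columnwise_product[of X _ _ nc "col M", OF X this] obtain Y where
    Y: "Y \<in> carrier_mat (rank M) nc" "\<And>j. j < nc \<Longrightarrow> col (X * Y) j = col M j" by metis
  have "M = X * Y" by (rule mat_col_eqI) (use M X Y in auto)
  then show ?thesis using X Y by blast
qed

text \<open>Here \<open>n\<close> independent columns form a basis, so every unit vector is a
  combination of columns of \<open>M\<close>; the coefficients of these combinations are the columns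
  of the right inverse.\<close>

lemma (in vec_space) full_rank_right_inverse:
  assumes M: "M \<in> carrier_mat n nc" and r: "rank M = n"
  shows "\<exists>N \<in> carrier_mat nc n. M * N = 1\<^sub>m n"
proof -
  obtain U where U: "finite U" "U \<subseteq> set (cols M)" "lin_indpt U" "card U = rank M"
    using maximal_indpt_cols[OF M] by metis
  have sub: "set (cols M) \<subseteq> carrier_vec n" using M cols_dim by blast
  have UV: "U \<subseteq> carrier_vec n" using U(2) sub by auto
  have "basis U"
    using dim_li_is_basis[OF fin_dim U(1) _ U(3)] UV U(4) r dim_is_n by simp
  then have "carrier_vec n \<subseteq> span (set (cols M))"
    using span_is_monotone[OF U(2)] unfolding basis_def by auto
  then have "\<exists>c \<in> carrier_vec nc. unit_vec n j = M *\<^sub>v c" if "j < n" for j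
    using in_span_cols_iff[OF M, of "unit_vec n j"] that by (metis subsetD unit_vec_carrier)
  from columnwise_product[of M _ _ n "unit_vec n", OF M this] obtain N where
    N: "N \<in> carrier_mat nc n" "\<And>j. j < n \<Longrightarrow> col (M * N) j = unit_vec n j" by metis
  have "M * N = 1\<^sub>m n" by (rule mat_col_eqI) (use M N in auto)
  then show ?thesis using N by blast
qed

lemma mrank_mult_le_inner:
  assumes "X \<in> carrier_mat r k" "Y \<in> carrier_mat k c"
  shows "mrank (X * Y) \<le> k"
  using vec_space.rank_mult_le_inner[OF assms] assms unfolding mrank_def by simp

lemma mrank_factorization:
  assumes "M \<in> carrier_mat r c"
  obtains X Y where "X \<in> carrier_mat r (mrank M)" "Y \<in> carrier_mat (mrank M) c" "M = X * Y"
  using vec_space.rank_factorization[OF assms] assms unfolding mrank_def by auto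

text \<open>Regrouping a factorization of \<open>M\<close> through its rank gives one of
  \<open>L * M\<close> with the same inner dimension.\<close>

lemma mrank_mult_le_right:
  assumes L: "L \<in> carrier_mat k r" and M: "M \<in> carrier_mat r c"
  shows "mrank (L * M) \<le> mrank M"
proof -
  obtain X Y where XY: "X \<in> carrier_mat r (mrank M)" "Y \<in> carrier_mat (mrank M) c" "M = X * Y"
    using mrank_factorization[OF M] .
  have "L * M = (L * X) * Y" using assoc_mult_mat[OF L XY(1,2)] XY(3) by metis
  moreover have "L * X \<in> carrier_mat k (mrank M)" using L XY(1) by (rule mult_carrier_mat)
  ultimately show ?thesis using mrank_mult_le_inner[OF _ XY(2)] by metis
qed

lemma full_row_rank_right_inverse:
  assumes "M \<in> carrier_mat r c" "full_row_rank M"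
  obtains N where "N \<in> carrier_mat c r" "M * N = 1\<^sub>m r"
  using vec_space.full_rank_right_inverse[OF assms(1)] assms
  unfolding full_row_rank_def mrank_def by auto

lemma mrank_one_mat: "mrank (1\<^sub>m k) = k"
  unfolding mrank_def using vec_space.det_rank_iff[of "1\<^sub>m k" k] by simp

subsection \<open>Row operations and rank\<close>

lemma append_rows_mult:
  fixes A B C :: "'a :: semiring_0 mat"
  assumes A: "A \<in> carrier_mat a c" and B: "B \<in> carrier_mat b c" and C: "C \<in> carrier_mat c e"
  shows "(A @\<^sub>r B) * C = A * C @\<^sub>r B * C"
proof (rule mat_col_eqI)
  fix j assume "j < dim_col (A * C @\<^sub>r B * C)"
  then have j: "j < e" using A B C by (auto simp: append_rows_def)
  have "col ((A @\<^sub>r B) * C) j = (A @\<^sub>r B) *\<^sub>v col C j"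
    using col_mult2[OF carrier_append_rows[OF A B] C j] .
  also have "\<dots> = A *\<^sub>v col C j @\<^sub>v B *\<^sub>v col C j"
    using C j by (intro mat_mult_append[OF A B]) auto
  also have "\<dots> = col (A * C @\<^sub>r B * C) j"
    \<comment> \<open>\<open>append_rows\<close> is a \<open>four_block_mat\<close> whose right half
      has no columns, hence the width 0 in the instantiation.\<close>
    unfolding append_rows_def using A B C j
    by (subst col_four_block_mat[of _ a e _ 0 _ b]) auto
  finally show "col ((A @\<^sub>r B) * C) j = col (A * C @\<^sub>r B * C) j" .
qed (use A B C in \<open>auto simp: append_rows_def\<close>)

lemma append_rows_assoc:
  assumes "A \<in> carrier_mat a d" "B \<in> carrier_mat b d" "C \<in> carrier_mat c d"
  shows "(A @\<^sub>r B) @\<^sub>r C = A @\<^sub>r B @\<^sub>r C"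
  using assms by (intro eq_matI) (auto simp: append_rows_def)

lemma append_rows_zero: "0\<^sub>m a d @\<^sub>r 0\<^sub>m b d = 0\<^sub>m (a + b) d"
  by (intro eq_matI) (auto simp: append_rows_def)

lemma append_rows_empty:
  assumes "A \<in> carrier_mat a d" "B \<in> carrier_mat 0 d"
  shows "A @\<^sub>r B = A"
  using assms by (intro eq_matI) (auto simp: append_rows_def)

text \<open>Zero rows are moved into a left factor, so that the number of rows that may be nonzero
  becomes an inner dimension.\<close>

lemma append_zero_rows_factor:
  fixes A :: "'a :: comm_ring_1 mat"
  assumes A: "A \<in> carrier_mat a d"
  shows "A @\<^sub>r 0\<^sub>m b d = (1\<^sub>m a @\<^sub>r 0\<^sub>m b a) * A"
  using append_rows_mult[of "1\<^sub>m a" a a "0\<^sub>m b a" b A d] A by simp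

text \<open>The left factor is the row selector [I 0], given an empty lower half so that block
  multiplication applies.\<close>

lemma top_rows_selector:
  fixes A B :: "'a :: comm_ring_1 mat"
  assumes A: "A \<in> carrier_mat a d" and B: "B \<in> carrier_mat b d"
  shows "four_block_mat (1\<^sub>m a) (0\<^sub>m a b) (0\<^sub>m 0 a) (0\<^sub>m 0 b) * (A @\<^sub>r B) = A"
proof -
  have "four_block_mat (1\<^sub>m a) (0\<^sub>m a b) (0\<^sub>m 0 a) (0\<^sub>m 0 b) * (A @\<^sub>r B)
      = four_block_mat (1\<^sub>m a * A + 0\<^sub>m a b * B) (1\<^sub>m a * 0\<^sub>m a 0 + 0\<^sub>m a b * 0\<^sub>m b 0)
          (0\<^sub>m 0 a * A + 0\<^sub>m 0 b * B) (0\<^sub>m 0 a * 0\<^sub>m a 0 + 0\<^sub>m 0 b * 0\<^sub>m b 0)"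
    unfolding append_rows_def using A B by (subst mult_four_block_mat[of _ a a _ b _ 0]) auto
  also have "\<dots> = A" using A B by (intro eq_matI) auto
  finally show ?thesis .
qed

text \<open>Acting by \<open>L\<close> on the upper rows only is left multiplication by the block
  diagonal matrix of \<open>L\<close> and an identity.\<close>

lemma mrank_append_mult_le:
  assumes L: "L \<in> carrier_mat k r" and A: "A \<in> carrier_mat r d" and Q: "Q \<in> carrier_mat q d"
  shows "mrank (L * A @\<^sub>r Q) \<le> mrank (A @\<^sub>r Q)"
proof -
  let ?D = "four_block_mat L (0\<^sub>m k q) (0\<^sub>m q r) (1\<^sub>m q)"
  have "?D * (A @\<^sub>r Q)
      = four_block_mat (L * A + 0\<^sub>m k q * Q) (L * 0\<^sub>m r 0 + 0\<^sub>m k q * 0\<^sub>m q 0)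
          (0\<^sub>m q r * A + 1\<^sub>m q * Q) (0\<^sub>m q r * 0\<^sub>m r 0 + 1\<^sub>m q * 0\<^sub>m q 0)"
    unfolding append_rows_def using L A Q by (subst mult_four_block_mat[of _ k r _ q _ q]) auto
  also have "\<dots> = L * A @\<^sub>r Q"
    unfolding append_rows_def using L A Q by (intro cong_four_block_mat) auto
  finally have "L * A @\<^sub>r Q = ?D * (A @\<^sub>r Q)" by simp
  moreover have "?D \<in> carrier_mat (k + q) (r + q)" using L by auto
  ultimately show ?thesis
    using mrank_mult_le_right[of ?D "k + q" "r + q" "A @\<^sub>r Q" d] A Q by auto
qed

text \<open>Left multiplication of the upper block raises neither its rank nor that of the stacked
  pair. Used for \<open>S\<close> and for its left inverse \<open>T\<close>, this makes both ranks
  invariant.\<close>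

lemma no_hidden_redundancy_cancel_left:
  assumes S: "S \<in> carrier_mat r r" and T: "T \<in> carrier_mat r r" and TS: "T * S = 1\<^sub>m r"
    and A: "A \<in> carrier_mat r d" and Q: "Q \<in> carrier_mat q d"
    and nh: "no_hidden_redundancy (S * A) Q"
  shows "no_hidden_redundancy A Q"
proof -
  have SA: "S * A \<in> carrier_mat r d" using S A by simp
  have TSA: "T * (S * A) = A"
    using assoc_mult_mat[OF T S A] TS A by simp
  have 1: "mrank (S * A) = mrank A"
    using mrank_mult_le_right[OF S A] mrank_mult_le_right[OF T SA] TSA by simp
  have 2: "mrank (S * A @\<^sub>r Q) = mrank (A @\<^sub>r Q)"
    using mrank_append_mult_le[OF S A Q] mrank_append_mult_le[OF T SA Q] TSA by simp
  show ?thesis using nh unfolding no_hidden_redundancy_def 1 2 .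
qed

lemma nonsingular_inverse:
  assumes "nonsingular k P"
  obtains Q where "Q \<in> carrier_mat k k" "Q * P = 1\<^sub>m k" "P * Q = 1\<^sub>m k"
proof -
  have P: "P \<in> carrier_mat k k" and "invertible_mat P"
    using assms unfolding nonsingular_def by auto
  then obtain Q where Q: "P * Q = 1\<^sub>m (dim_row P)" "Q * P = 1\<^sub>m (dim_row Q)"
    unfolding invertible_mat_def inverts_mat_def by auto
  have "dim_row Q = k"
    using arg_cong[OF Q(2), of dim_col] P by simp
  moreover have "dim_col Q = k"
    using arg_cong[OF Q(1), of dim_col] P by simp
  ultimately show thesis using that[of Q] Q P by auto
qed

text \<open>The two products share the left factor \<open>X\<close>, so
  \<open>X * (T * U + T' * V)\<close> is available for all \<open>U\<close> and \<open>V\<close>.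
  Right inverses of \<open>A\<close> and \<open>B'\<close> allow a choice that makes it the identity
  of size \<open>a + b\<close>, which has to pass through \<open>s\<close> columns. In the
  application, \<open>T\<close> and \<open>T'\<close> are the rows in which the leading two
  coefficients of a reduced system may be nonzero.\<close>

lemma staircase_row_bound:
  fixes X :: "real mat"
  assumes A: "A \<in> carrier_mat a d" "full_row_rank A"
    and B: "B \<in> carrier_mat a d"
    and B': "B' \<in> carrier_mat b d" "full_row_rank B'"
    and X: "X \<in> carrier_mat (a + b) s" and T: "T \<in> carrier_mat s d" "T' \<in> carrier_mat s d"
    and eq: "A @\<^sub>r 0\<^sub>m b d = X * T" "B @\<^sub>r B' = X * T'"
  shows "a + b \<le> s"
proof -
  obtain N where N: "N \<in> carrier_mat d a" "A * N = 1\<^sub>m a"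
    using full_row_rank_right_inverse[OF A] .
  obtain N' where N': "N' \<in> carrier_mat d b" "B' * N' = 1\<^sub>m b"
    using full_row_rank_right_inverse[OF B'] .
  have BN: "B * N' \<in> carrier_mat a b" using B N' by simp
  \<comment> \<open>\<open>V\<close> produces the lower identity block from \<open>B'\<close>, at
    the price of \<open>B * N'\<close> in the upper right corner. The second block of
    \<open>U\<close> is chosen so that \<open>A\<close> turns it into the negative of this
    corner.\<close>
  define U where "U = four_block_mat N (- (N * (B * N'))) (0\<^sub>m 0 a) (0\<^sub>m 0 b)"
  define V where "V = four_block_mat (0\<^sub>m d a) N' (0\<^sub>m 0 a) (0\<^sub>m 0 b)"
  have U: "U \<in> carrier_mat d (a + b)"
    unfolding U_def using four_block_carrier_mat[OF N(1), of "0\<^sub>m 0 b" 0 b] by simp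
  have V: "V \<in> carrier_mat d (a + b)"
    unfolding V_def using four_block_carrier_mat[of "0\<^sub>m d a" d a "0\<^sub>m 0 b" 0 b] by simp
  have ANBN: "A * - (N * (B * N')) = - (B * N')"
    using assoc_mult_mat[OF A(1) N(1) BN] N A(1) BN uminus_mult_right_mat[of A "N * (B * N')"]
      left_mult_one_mat[OF BN] by simp
  have "X * T * U = four_block_mat (A * N + 0\<^sub>m a 0 * 0\<^sub>m 0 a) (A * - (N * (B * N')) + 0\<^sub>m a 0 * 0\<^sub>m 0 b)
      (0\<^sub>m b d * N + 0\<^sub>m b 0 * 0\<^sub>m 0 a) (0\<^sub>m b d * - (N * (B * N')) + 0\<^sub>m b 0 * 0\<^sub>m 0 b)"
    unfolding eq(1)[symmetric] U_def append_rows_def using A(1) N(1) BN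
    by (subst mult_four_block_mat[of _ a d _ 0 _ b]) auto
  also have "\<dots> = four_block_mat (1\<^sub>m a) (- (B * N')) (0\<^sub>m b a) (0\<^sub>m b b)"
    unfolding ANBN N(2) using N(1) BN by (intro cong_four_block_mat) (auto intro!: eq_matI)
  finally have 1: "X * T * U = four_block_mat (1\<^sub>m a) (- (B * N')) (0\<^sub>m b a) (0\<^sub>m b b)" .
  have "X * T' * V = four_block_mat (B * 0\<^sub>m d a + 0\<^sub>m a 0 * 0\<^sub>m 0 a) (B * N' + 0\<^sub>m a 0 * 0\<^sub>m 0 b)
      (B' * 0\<^sub>m d a + 0\<^sub>m b 0 * 0\<^sub>m 0 a) (B' * N' + 0\<^sub>m b 0 * 0\<^sub>m 0 b)"
    unfolding eq(2)[symmetric] V_def append_rows_def using B B' N'(1)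
    by (subst mult_four_block_mat[of _ a d _ 0 _ b]) auto
  also have "\<dots> = four_block_mat (0\<^sub>m a a) (B * N') (0\<^sub>m b a) (1\<^sub>m b)"
    unfolding N'(2) using B B' BN by (intro cong_four_block_mat) auto
  finally have 2: "X * T' * V = four_block_mat (0\<^sub>m a a) (B * N') (0\<^sub>m b a) (1\<^sub>m b)" .
  have TU: "T * U \<in> carrier_mat s (a + b)" "T' * V \<in> carrier_mat s (a + b)"
    using T U V by auto
  have "X * (T * U + T' * V) = X * T * U + X * T' * V"
    using mult_add_distrib_mat[OF X TU] assoc_mult_mat[OF X T(1) U] assoc_mult_mat[OF X T(2) V] by simp
  also have "\<dots> = four_block_mat (1\<^sub>m a + 0\<^sub>m a a) (- (B * N') + B * N') (0\<^sub>m b a + 0\<^sub>m b a) (0\<^sub>m b b + 1\<^sub>m b)"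
    unfolding 1 2 using BN by (intro add_four_block_mat) auto
  also have "\<dots> = four_block_mat (1\<^sub>m a) (0\<^sub>m a b) (0\<^sub>m b a) (1\<^sub>m b)"
    using BN uminus_l_inv_mat[OF BN] by (intro cong_four_block_mat) auto
  also have "\<dots> = 1\<^sub>m (a + b)" by (rule four_block_one_mat)
  finally have "mrank (X * (T * U + T' * V)) = a + b" using mrank_one_mat by simp
  moreover have "T * U + T' * V \<in> carrier_mat s (a + b)" using TU by auto
  ultimately show ?thesis using mrank_mult_le_inner[OF X] by metis
qed

lemma full_row_rank_row_bound:
  fixes X :: "real mat"
  assumes A: "A \<in> carrier_mat a d" "full_row_rank A"
    and X: "X \<in> carrier_mat a s" and T: "T \<in> carrier_mat s d"
    and eq: "A = X * T"
  shows "a \<le> s"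
  using mrank_mult_le_inner[OF X T] A unfolding full_row_rank_def eq[symmetric] by auto

text \<open>Repeated use peels off one block row at a time and turns a stacked system into a
  conjunction of block equations.\<close>

lemma append_system_iff:
  fixes U1 :: "real mat"
  assumes "U1 \<in> carrier_mat a d" "V1 \<in> carrier_mat a d" "W1 \<in> carrier_mat a d"
    and "U2 \<in> carrier_mat b d" "V2 \<in> carrier_mat b d" "W2 \<in> carrier_mat b d"
    and "x \<in> carrier_vec d" "y \<in> carrier_vec d" "z \<in> carrier_vec d"
    and "g1 \<in> carrier_vec a"
  shows "(U1 @\<^sub>r U2) *\<^sub>v x + (V1 @\<^sub>r V2) *\<^sub>v y + (W1 @\<^sub>r W2) *\<^sub>v z = g1 @\<^sub>v g2 \<longleftrightarrow>
    U1 *\<^sub>v x + V1 *\<^sub>v y + W1 *\<^sub>v z = g1 \<and> U2 *\<^sub>v x + V2 *\<^sub>v y + W2 *\<^sub>v z = g2"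
proof -
  have c: "U1 *\<^sub>v x \<in> carrier_vec a" "V1 *\<^sub>v y \<in> carrier_vec a" "W1 *\<^sub>v z \<in> carrier_vec a"
    "U2 *\<^sub>v x \<in> carrier_vec b" "V2 *\<^sub>v y \<in> carrier_vec b" "W2 *\<^sub>v z \<in> carrier_vec b"
    using assms by (auto intro: mult_mat_vec_carrier)
  have "(U1 @\<^sub>r U2) *\<^sub>v x + (V1 @\<^sub>r V2) *\<^sub>v y + (W1 @\<^sub>r W2) *\<^sub>v z
      = (U1 *\<^sub>v x + V1 *\<^sub>v y + W1 *\<^sub>v z) @\<^sub>v (U2 *\<^sub>v x + V2 *\<^sub>v y + W2 *\<^sub>v z)"
    unfolding mat_mult_append[OF assms(1,4,7)] mat_mult_append[OF assms(2,5,8)]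
      mat_mult_append[OF assms(3,6,9)]
    using c by (simp add: append_vec_add[of _ a _ _ b])
  moreover have "U1 *\<^sub>v x + V1 *\<^sub>v y + W1 *\<^sub>v z \<in> carrier_vec a" using c by auto
  ultimately show ?thesis using append_vec_eq[OF _ assms(10)] by simp
qed

lemma zero_mat_mult_vec: "x \<in> carrier_vec d \<Longrightarrow> 0\<^sub>m a d *\<^sub>v x = (0\<^sub>v a :: real vec)"
  by (intro eq_vecI) auto

subsection \<open>Solutions of staircase systems\<close>

text \<open>The zero rows of the staircase remain as the solvability condition
  \<open>0\<^sub>v s = g4 n\<close>. Their number \<open>s\<close> is one fixed value, as constant
  block sizes provide. The type \<open>blocks_scheme\<close> admits condensed forms as well as bare
  blocks.\<close>

definition staircase_solutions :: "nat \<Rightarrow> nat \<Rightarrow> 'a blocks_scheme \<Rightarrow> (nat \<Rightarrow> real vec) \<Rightarrow>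
    (nat \<Rightarrow> real vec) \<Rightarrow> (nat \<Rightarrow> real vec) \<Rightarrow> (nat \<Rightarrow> real vec) \<Rightarrow> nat \<Rightarrow> (nat \<Rightarrow> real vec) set" where
  "staircase_solutions n0 d K g1 g2 g3 g4 s = {x. \<forall>n\<ge>n0. x n \<in> carrier_vec d \<and>
     blkA1 K n *\<^sub>v x (n + 2) + blkB1 K n *\<^sub>v x (n + 1) + blkC1 K n *\<^sub>v x n = g1 n \<and>
     blkB2 K n *\<^sub>v x (n + 1) + blkC2 K n *\<^sub>v x n = g2 n \<and>
     blkC3 K n *\<^sub>v x n = g3 n \<and> 0\<^sub>v s = g4 n}"

lemma size_eqs:
  assumes "blocks_dims n0 d r2 r1 r0 K" "n \<ge> n0"
  shows "size2 K n = r2 n" "size1 K n = r1 n" "size0 K n = r0 n"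
  using assms unfolding blocks_dims_def size2_def size1_def size0_def by auto

lemma solution_set_block_side:
  assumes dims: "blocks_dims n0 d r2 r1 r0 K"
    and rhs: "rhs_dims n0 r2 r1 r0 v g1 g2 g3 g4"
    and v: "\<And>n. n \<ge> n0 \<Longrightarrow> v n = s"
  shows "solution_set n0 d (block_side d v K g1 g2 g3 g4) = staircase_solutions n0 d K g1 g2 g3 g4 s"
proof -
  have "coefA (block_side d v K g1 g2 g3 g4) n *\<^sub>v x (n + 2)
        + coefB (block_side d v K g1 g2 g3 g4) n *\<^sub>v x (n + 1)
        + coefC (block_side d v K g1 g2 g3 g4) n *\<^sub>v x n = inhom (block_side d v K g1 g2 g3 g4) n \<longleftrightarrow>
     blkA1 K n *\<^sub>v x (n + 2) + blkB1 K n *\<^sub>v x (n + 1) + blkC1 K n *\<^sub>v x n = g1 n \<and>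
     blkB2 K n *\<^sub>v x (n + 1) + blkC2 K n *\<^sub>v x n = g2 n \<and>
     blkC3 K n *\<^sub>v x n = g3 n \<and> 0\<^sub>v s = g4 n"
    if n: "n \<ge> n0" and x: "\<And>n. n \<ge> n0 \<Longrightarrow> x n \<in> carrier_vec d" for x n
  proof -
    have x: "x (n + 2) \<in> carrier_vec d" "x (n + 1) \<in> carrier_vec d" "x n \<in> carrier_vec d"
      using n x by auto
    have K: "blkA1 K n \<in> carrier_mat (r2 n) d" "blkB1 K n \<in> carrier_mat (r2 n) d"
      "blkC1 K n \<in> carrier_mat (r2 n) d" "blkB2 K n \<in> carrier_mat (r1 n) d"
      "blkC2 K n \<in> carrier_mat (r1 n) d" "blkC3 K n \<in> carrier_mat (r0 n) d"
      using dims n unfolding blocks_dims_def by auto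
    have g: "g1 n \<in> carrier_vec (r2 n)" "g2 n \<in> carrier_vec (r1 n)" "g3 n \<in> carrier_vec (r0 n)"
      using rhs n unfolding rhs_dims_def by auto
    have c: "blkB2 K n *\<^sub>v x (n + 1) \<in> carrier_vec (r1 n)" "blkC2 K n *\<^sub>v x n \<in> carrier_vec (r1 n)"
      "blkC3 K n *\<^sub>v x n \<in> carrier_vec (r0 n)"
      using K x by (auto intro: mult_mat_vec_carrier)
    have z: "0\<^sub>m a d *\<^sub>v x (n + 2) = (0\<^sub>v a :: real vec)" "0\<^sub>m a d *\<^sub>v x (n + 1) = (0\<^sub>v a :: real vec)"
      "0\<^sub>m a d *\<^sub>v x n = (0\<^sub>v a :: real vec)" for a
      using x zero_mat_mult_vec by blast+
    have l3: "0\<^sub>m (r0 n) d @\<^sub>r 0\<^sub>m s d \<in> carrier_mat (r0 n + s) d"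
      "blkC3 K n @\<^sub>r 0\<^sub>m s d \<in> carrier_mat (r0 n + s) d" using K by auto
    have l2: "0\<^sub>m (r1 n) d @\<^sub>r 0\<^sub>m (r0 n) d @\<^sub>r 0\<^sub>m s d \<in> carrier_mat (r1 n + (r0 n + s)) d"
      "blkB2 K n @\<^sub>r 0\<^sub>m (r0 n) d @\<^sub>r 0\<^sub>m s d \<in> carrier_mat (r1 n + (r0 n + s)) d"
      "blkC2 K n @\<^sub>r blkC3 K n @\<^sub>r 0\<^sub>m s d \<in> carrier_mat (r1 n + (r0 n + s)) d"
      using K l3 by auto
    show ?thesis
      unfolding block_side_def side.simps size_eqs[OF dims n] v[OF n]
        append_system_iff[OF K(1-3) l2 x g(1)]
        append_system_iff[OF zero_carrier_mat K(4,5) l3(1) l3 x g(2)]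
        append_system_iff[OF zero_carrier_mat zero_carrier_mat K(6)
          zero_carrier_mat zero_carrier_mat zero_carrier_mat x g(3)]
        z using c by simp
  qed
  then show ?thesis unfolding solution_set_def staircase_solutions_def by blast
qed

lemma solution_set_scaled:
  assumes dims: "side_dims n0 m d E"
    and P: "\<And>n. n \<ge> n0 \<Longrightarrow> nonsingular m (P n)"
    and F: "same_side n0 (scaled_side P E) F"
  shows "solution_set n0 d E = solution_set n0 d F"
proof -
  have "coefA E n *\<^sub>v x (n + 2) + coefB E n *\<^sub>v x (n + 1) + coefC E n *\<^sub>v x n = inhom E n \<longleftrightarrow>
      coefA F n *\<^sub>v x (n + 2) + coefB F n *\<^sub>v x (n + 1) + coefC F n *\<^sub>v x n = inhom F n"
    if n: "n \<ge> n0" and x: "\<And>n. n \<ge> n0 \<Longrightarrow> x n \<in> carrier_vec d" for x n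
  proof -
    have x: "x (n + 2) \<in> carrier_vec d" "x (n + 1) \<in> carrier_vec d" "x n \<in> carrier_vec d"
      using n x by auto
    have E: "coefA E n \<in> carrier_mat m d" "coefB E n \<in> carrier_mat m d" "coefC E n \<in> carrier_mat m d"
      "inhom E n \<in> carrier_vec m" using dims n unfolding side_dims_def by auto
    have F: "coefA F n = P n * coefA E n" "coefB F n = P n * coefB E n" "coefC F n = P n * coefC E n"
      "inhom F n = P n *\<^sub>v inhom E n" using F n unfolding same_side_def scaled_side_def by auto
    obtain Q where Q: "Q \<in> carrier_mat m m" "Q * P n = 1\<^sub>m m"
      using nonsingular_inverse[OF P[OF n]] by metis
    have Pn: "P n \<in> carrier_mat m m" using P[OF n] unfolding nonsingular_def by auto
    let ?l = "coefA E n *\<^sub>v x (n + 2) + coefB E n *\<^sub>v x (n + 1) + coefC E n *\<^sub>v x n"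
    have c: "coefA E n *\<^sub>v x (n + 2) \<in> carrier_vec m" "coefB E n *\<^sub>v x (n + 1) \<in> carrier_vec m"
      "coefC E n *\<^sub>v x n \<in> carrier_vec m" using E x by (auto intro: mult_mat_vec_carrier)
    have l: "?l \<in> carrier_vec m" using c by simp
    have "coefA F n *\<^sub>v x (n + 2) + coefB F n *\<^sub>v x (n + 1) + coefC F n *\<^sub>v x n = P n *\<^sub>v ?l"
      unfolding F assoc_mult_mat_vec[OF Pn E(1) x(1)] assoc_mult_mat_vec[OF Pn E(2) x(2)]
        assoc_mult_mat_vec[OF Pn E(3) x(3)]
        mult_add_distrib_mat_vec[OF Pn add_carrier_vec[OF c(1,2)] c(3)]
        mult_add_distrib_mat_vec[OF Pn c(1,2)] ..
    moreover have "P n *\<^sub>v ?l = P n *\<^sub>v inhom E n \<Longrightarrow> ?l = inhom E n"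
      using assoc_mult_mat_vec[OF Q(1) Pn l] assoc_mult_mat_vec[OF Q(1) Pn E(4)] Q(2)
        one_mult_mat_vec[OF l] one_mult_mat_vec[OF E(4)] by metis
    ultimately show ?thesis unfolding F(4) by metis
  qed
  then show ?thesis unfolding solution_set_def by blast
qed

text \<open>Only the last claim is more than unfolding. Since \<open>sizev\<close> is a truncated
  difference, the sum is read off from the length of the scaled right-hand side, which is the
  concatenation of the four parts.\<close>

lemma condensed_form_dims:
  assumes dims: "side_dims n0 m d E" and K: "is_condensed_form n0 m d E K" and n: "n \<ge> n0"
  shows "blkA1 K n \<in> carrier_mat (size2 K n) d" "blkB1 K n \<in> carrier_mat (size2 K n) d"
    "blkC1 K n \<in> carrier_mat (size2 K n) d" "blkB2 K n \<in> carrier_mat (size1 K n) d"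
    "blkC2 K n \<in> carrier_mat (size1 K n) d" "blkC3 K n \<in> carrier_mat (size0 K n) d"
    "rhs1 K n \<in> carrier_vec (size2 K n)" "rhs2 K n \<in> carrier_vec (size1 K n)"
    "rhs3 K n \<in> carrier_vec (size0 K n)" "rhs4 K n \<in> carrier_vec (sizev m K n)"
    "size2 K n + size1 K n + size0 K n + sizev m K n = m"
proof -
  show c: "blkA1 K n \<in> carrier_mat (size2 K n) d" "blkB1 K n \<in> carrier_mat (size2 K n) d"
    "blkC1 K n \<in> carrier_mat (size2 K n) d" "blkB2 K n \<in> carrier_mat (size1 K n) d"
    "blkC2 K n \<in> carrier_mat (size1 K n) d" "blkC3 K n \<in> carrier_mat (size0 K n) d"
    "rhs1 K n \<in> carrier_vec (size2 K n)" "rhs2 K n \<in> carrier_vec (size1 K n)"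
    "rhs3 K n \<in> carrier_vec (size0 K n)" "rhs4 K n \<in> carrier_vec (sizev m K n)"
    using K n unfolding is_condensed_form_def blocks_dims_def rhs_dims_def by auto
  have "scaling K n *\<^sub>v inhom E n = rhs1 K n @\<^sub>v rhs2 K n @\<^sub>v rhs3 K n @\<^sub>v rhs4 K n"
    and P: "scaling K n \<in> carrier_mat m m"
    using K n unfolding is_condensed_form_def same_side_def scaled_side_def block_side_def nonsingular_def
    by auto
  from arg_cong[OF this(1), of dim_vec] show "size2 K n + size1 K n + size0 K n + sizev m K n = m"
    using P c(7-10) by simp
qed

lemma solution_set_condensed:
  assumes dims: "side_dims n0 m d E" and K: "is_condensed_form n0 m d E K"
    and v: "\<And>n. n \<ge> n0 \<Longrightarrow> sizev m K n = s"
  shows "solution_set n0 d E = staircase_solutions n0 d K (rhs1 K) (rhs2 K) (rhs3 K) (rhs4 K) s"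
proof -
  have P: "\<And>n. n \<ge> n0 \<Longrightarrow> nonsingular m (scaling K n)"
    and b: "blocks_dims n0 d (size2 K) (size1 K) (size0 K) K"
    and r: "rhs_dims n0 (size2 K) (size1 K) (size0 K) (sizev m K) (rhs1 K) (rhs2 K) (rhs3 K) (rhs4 K)"
    and F: "same_side n0 (scaled_side (scaling K) E)
       (block_side d (sizev m K) K (rhs1 K) (rhs2 K) (rhs3 K) (rhs4 K))"
    using K unfolding is_condensed_form_def by auto
  show ?thesis
    using solution_set_scaled[OF dims P F] solution_set_block_side[OF b r v] by simp
qed

subsection \<open>The reduction step\<close>

text \<open>The transpose undoes an orthogonal matrix. An equation may therefore be split into its
  \<open>S\<close> part, which is kept, and its \<open>Z\<close> part, which is rewritten with later
  equations.\<close>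

lemma orthogonal_cancel:
  assumes S: "S \<in> carrier_mat s r" and Z: "Z \<in> carrier_mat z r"
    and Q: "orthogonal_matrix_of_size r (S @\<^sub>r Z)"
    and u: "u \<in> carrier_vec r" and g: "g \<in> carrier_vec r"
  shows "u = g \<longleftrightarrow> S *\<^sub>v u = S *\<^sub>v g \<and> Z *\<^sub>v u = Z *\<^sub>v g"
proof
  assume eq: "S *\<^sub>v u = S *\<^sub>v g \<and> Z *\<^sub>v u = Z *\<^sub>v g"
  let ?Q = "S @\<^sub>r Z"
  have Qc: "?Q \<in> carrier_mat r r" "?Q\<^sup>T * ?Q = 1\<^sub>m r"
    using Q unfolding orthogonal_matrix_of_size_def by auto
  have "?Q *\<^sub>v u = ?Q *\<^sub>v g"
    using eq mat_mult_append[OF S Z u] mat_mult_append[OF S Z g] by simp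
  then have "?Q\<^sup>T *\<^sub>v (?Q *\<^sub>v u) = ?Q\<^sup>T *\<^sub>v (?Q *\<^sub>v g)" by simp
  then show "u = g"
    using assoc_mult_mat_vec[of "?Q\<^sup>T" r r ?Q r] Qc u g by (simp flip: assoc_mult_mat_vec)
qed simp

text \<open>The relation \<open>z\<close> trades the leading term \<open>a\<close> for
  \<open>p\<close> and \<open>q\<close> on the other side, and \<open>k\<close> is added to both
  sides. In the top rows \<open>p + k\<close> is \<open>Z'\<close> applied to the left side of the
  next middle equation, hence known; in the middle rows \<open>b\<close>, \<open>p\<close> and
  \<open>k\<close> are zero.\<close>

lemma vec_move_terms:
  fixes a b c e p q k :: "real vec"
  assumes "a \<in> carrier_vec r" "b \<in> carrier_vec r" "c \<in> carrier_vec r" "e \<in> carrier_vec r"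
    "p \<in> carrier_vec r" "q \<in> carrier_vec r" "k \<in> carrier_vec r"
    and z: "a + p + q = 0\<^sub>v r"
  shows "a + b + c = e \<longleftrightarrow> (b + k) + c = e + (p + k) + q"
proof -
  note dims = assms(1-7)[THEN carrier_vecD]
  have "a $ i + p $ i + q $ i = 0" if "i < r" for i
    using arg_cong[OF z, of "\<lambda>v. v $ i"] dims that by simp
  then have "a $ i + b $ i + c $ i = e $ i \<longleftrightarrow> b $ i + k $ i + c $ i = e $ i + (p $ i + k $ i) + q $ i"
    if "i < r" for i using that by (smt (verit))
  moreover have "a + b + c = e \<longleftrightarrow> (\<forall>i<r. a $ i + b $ i + c $ i = e $ i)"
    using dims by (auto simp: vec_eq_iff)
  moreover have "(b + k) + c = e + (p + k) + q \<longleftrightarrow>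
      (\<forall>i<r. b $ i + k $ i + c $ i = e $ i + (p $ i + k $ i) + q $ i)"
    using dims by (auto simp: vec_eq_iff)
  ultimately show ?thesis by blast
qed

text \<open>On the \<open>Z\<close> rows, \<open>Z * B\<close> is the negative of
  \<open>Z' * C'\<close>, and \<open>C' *\<^sub>v x1\<close> is known from the bottom equation one
  step later. The leading term turns into data, and these rows constrain only
  \<open>x0\<close>.\<close>

lemma middle_rows_reduction:
  fixes S :: "real mat"
  assumes S: "S \<in> carrier_mat s r" and Z: "Z \<in> carrier_mat z r"
    and Q: "orthogonal_matrix_of_size r (S @\<^sub>r Z)"
    and B: "B \<in> carrier_mat r d" "C \<in> carrier_mat r d"
    and Z': "Z' \<in> carrier_mat z r'" and C': "C' \<in> carrier_mat r' d"
    and zero: "Z * B + Z' * C' = 0\<^sub>m z d"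
    and x: "x1 \<in> carrier_vec d" "x0 \<in> carrier_vec d"
    and g: "g \<in> carrier_vec r" and C'x: "C' *\<^sub>v x1 = g'"
  shows "B *\<^sub>v x1 + C *\<^sub>v x0 = g \<longleftrightarrow>
    (S * B) *\<^sub>v x1 + (S * C) *\<^sub>v x0 = S *\<^sub>v g \<and> (Z * C) *\<^sub>v x0 = Z *\<^sub>v g + Z' *\<^sub>v g'"
proof -
  note mc = mult_mat_vec_carrier
  have Bx: "B *\<^sub>v x1 \<in> carrier_vec r" and Cx: "C *\<^sub>v x0 \<in> carrier_vec r"
    using mc[OF B(1) x(1)] mc[OF B(2) x(2)] by auto
  have "C' *\<^sub>v x1 \<in> carrier_vec r'" using mc[OF C' x(1)] .
  then have g': "g' \<in> carrier_vec r'" using C'x by simp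
  have S1: "S *\<^sub>v (B *\<^sub>v x1 + C *\<^sub>v x0) = (S * B) *\<^sub>v x1 + (S * C) *\<^sub>v x0"
    unfolding mult_add_distrib_mat_vec[OF S Bx Cx] assoc_mult_mat_vec[OF S B(1) x(1)]
      assoc_mult_mat_vec[OF S B(2) x(2)] ..
  have Z1: "Z *\<^sub>v (B *\<^sub>v x1 + C *\<^sub>v x0) = (Z * B) *\<^sub>v x1 + (Z * C) *\<^sub>v x0"
    unfolding mult_add_distrib_mat_vec[OF Z Bx Cx] assoc_mult_mat_vec[OF Z B(1) x(1)]
      assoc_mult_mat_vec[OF Z B(2) x(2)] ..
  have ZB: "Z * B \<in> carrier_mat z d" and ZC: "Z * C \<in> carrier_mat z d"
    and Z'C': "Z' * C' \<in> carrier_mat z d" using Z B Z' C' by auto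
  have "(Z * B) *\<^sub>v x1 + (Z' * C') *\<^sub>v x1 = 0\<^sub>v z"
    unfolding add_mult_distrib_mat_vec[OF ZB Z'C' x(1), symmetric] zero zero_mat_mult_vec[OF x(1)] ..
  then have 0: "(Z * B) *\<^sub>v x1 + Z' *\<^sub>v g' = 0\<^sub>v z"
    unfolding assoc_mult_mat_vec[OF Z' C' x(1)] C'x .
  have c: "(Z * B) *\<^sub>v x1 \<in> carrier_vec z" "(Z * C) *\<^sub>v x0 \<in> carrier_vec z"
    "Z *\<^sub>v g \<in> carrier_vec z" "Z' *\<^sub>v g' \<in> carrier_vec z"
    using mc[OF ZB x(1)] mc[OF ZC x(2)] mc[OF Z g] mc[OF Z' g'] by auto
  have "(Z * B) *\<^sub>v x1 + (Z * C) *\<^sub>v x0 = Z *\<^sub>v g \<longleftrightarrow> (Z * C) *\<^sub>v x0 = Z *\<^sub>v g + Z' *\<^sub>v g'"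
    using vec_move_terms[OF c(1) zero_carrier_vec c(2,3) zero_carrier_vec c(4) zero_carrier_vec] 0 c
    by simp
  then show ?thesis
    unfolding orthogonal_cancel[OF S Z Q add_carrier_vec[OF Bx Cx] g] S1 Z1 by simp
qed

text \<open>The leading term is eliminated with the middle equation one step later and the bottom
  equation two steps later. The middle equation brings a lower-order term with it, which is why
  \<open>Z' * C'\<close> enters the coefficient of \<open>x1\<close>.\<close>

lemma top_rows_reduction:
  fixes S :: "real mat"
  assumes S: "S \<in> carrier_mat s r" and Z: "Z \<in> carrier_mat z r"
    and Q: "orthogonal_matrix_of_size r (S @\<^sub>r Z)"
    and A: "A \<in> carrier_mat r d" "B \<in> carrier_mat r d" "C \<in> carrier_mat r d"
    and Z': "Z' \<in> carrier_mat z r'" and B': "B' \<in> carrier_mat r' d" "C' \<in> carrier_mat r' d"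
    and Z'': "Z'' \<in> carrier_mat z r''" and C'': "C'' \<in> carrier_mat r'' d"
    and zero: "Z * A + Z' * B' + Z'' * C'' = 0\<^sub>m z d"
    and x: "x2 \<in> carrier_vec d" "x1 \<in> carrier_vec d" "x0 \<in> carrier_vec d"
    and g: "g \<in> carrier_vec r"
    and g': "B' *\<^sub>v x2 + C' *\<^sub>v x1 = g'" and g'': "C'' *\<^sub>v x2 = g''"
  shows "A *\<^sub>v x2 + B *\<^sub>v x1 + C *\<^sub>v x0 = g \<longleftrightarrow>
    (S * A) *\<^sub>v x2 + (S * B) *\<^sub>v x1 + (S * C) *\<^sub>v x0 = S *\<^sub>v g \<and>
    (Z * B + Z' * C') *\<^sub>v x1 + (Z * C) *\<^sub>v x0 = Z *\<^sub>v g + Z' *\<^sub>v g' + Z'' *\<^sub>v g''"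
proof -
  note mc = mult_mat_vec_carrier
  have Ax: "A *\<^sub>v x2 \<in> carrier_vec r" and Bx: "B *\<^sub>v x1 \<in> carrier_vec r"
    and Cx: "C *\<^sub>v x0 \<in> carrier_vec r" and Bx': "B' *\<^sub>v x2 \<in> carrier_vec r'"
    and Cx': "C' *\<^sub>v x1 \<in> carrier_vec r'"
    using mc[OF A(1) x(1)] mc[OF A(2) x(2)] mc[OF A(3) x(3)] mc[OF B'(1) x(1)] mc[OF B'(2) x(2)] by auto
  have gc'': "g'' \<in> carrier_vec r''" using mc[OF C'' x(1)] g'' by simp
  have distr: "M *\<^sub>v (A *\<^sub>v x2 + B *\<^sub>v x1 + C *\<^sub>v x0)
      = (M * A) *\<^sub>v x2 + (M * B) *\<^sub>v x1 + (M * C) *\<^sub>v x0" if M: "M \<in> carrier_mat k r" for M k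
    unfolding mult_add_distrib_mat_vec[OF M add_carrier_vec[OF Ax Bx] Cx]
      mult_add_distrib_mat_vec[OF M Ax Bx] assoc_mult_mat_vec[OF M A(1) x(1)]
      assoc_mult_mat_vec[OF M A(2) x(2)] assoc_mult_mat_vec[OF M A(3) x(3)] ..
  have ZA: "Z * A \<in> carrier_mat z d" and ZB: "Z * B \<in> carrier_mat z d" and ZC: "Z * C \<in> carrier_mat z d"
    and ZB': "Z' * B' \<in> carrier_mat z d" and ZC': "Z' * C' \<in> carrier_mat z d"
    and ZC'': "Z'' * C'' \<in> carrier_mat z d" using Z A Z' B' Z'' C'' by auto
  have "(Z * A) *\<^sub>v x2 + (Z' * B') *\<^sub>v x2 + (Z'' * C'') *\<^sub>v x2 = 0\<^sub>v z"
    unfolding add_mult_distrib_mat_vec[OF ZA ZB' x(1), symmetric]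
      add_mult_distrib_mat_vec[OF add_carrier_mat[OF ZB', of "Z * A"] ZC'' x(1), symmetric]
      zero zero_mat_mult_vec[OF x(1)] ..
  then have 0: "(Z * A) *\<^sub>v x2 + (Z' * B') *\<^sub>v x2 + Z'' *\<^sub>v g'' = 0\<^sub>v z"
    unfolding assoc_mult_mat_vec[OF Z'' C'' x(1)] g'' .
  have Zg': "Z' *\<^sub>v g' = (Z' * B') *\<^sub>v x2 + (Z' * C') *\<^sub>v x1"
    unfolding g'[symmetric] mult_add_distrib_mat_vec[OF Z' Bx' Cx'] assoc_mult_mat_vec[OF Z' B'(1) x(1)]
      assoc_mult_mat_vec[OF Z' B'(2) x(2)] ..
  have c: "(Z * A) *\<^sub>v x2 \<in> carrier_vec z" "(Z * B) *\<^sub>v x1 \<in> carrier_vec z"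
    "(Z * C) *\<^sub>v x0 \<in> carrier_vec z" "Z *\<^sub>v g \<in> carrier_vec z"
    "(Z' * B') *\<^sub>v x2 \<in> carrier_vec z" "Z'' *\<^sub>v g'' \<in> carrier_vec z" "(Z' * C') *\<^sub>v x1 \<in> carrier_vec z"
    using mc[OF ZA x(1)] mc[OF ZB x(2)] mc[OF ZC x(3)] mc[OF Z g] mc[OF ZB' x(1)] mc[OF Z'' gc'']
      mc[OF ZC' x(2)] by auto
  have "(Z * A) *\<^sub>v x2 + (Z * B) *\<^sub>v x1 + (Z * C) *\<^sub>v x0 = Z *\<^sub>v g \<longleftrightarrow>
      (Z * B + Z' * C') *\<^sub>v x1 + (Z * C) *\<^sub>v x0 = Z *\<^sub>v g + Z' *\<^sub>v g' + Z'' *\<^sub>v g''"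
    unfolding add_mult_distrib_mat_vec[OF ZB ZC' x(2)] Zg' by (rule vec_move_terms[OF c 0])
  then show ?thesis
    unfolding orthogonal_cancel[OF S Z Q add_carrier_vec[OF add_carrier_vec[OF Ax Bx] Cx] g]
      distr[OF S] distr[OF Z] by simp
qed

lemma admissible_reductionD:
  assumes "admissible_reduction n0 d K R" "n \<ge> n0"
  shows "S1 R n \<in> carrier_mat (dim_row (S1 R n)) (size1 K n)"
    "Z1 R n \<in> carrier_mat (dim_row (Z1 R n)) (size1 K n)"
    "Z3 R n \<in> carrier_mat (dim_row (Z1 R n)) (size0 K (n + 1))"
    "S2 R n \<in> carrier_mat (dim_row (S2 R n)) (size2 K n)"
    "Z2 R n \<in> carrier_mat (dim_row (Z2 R n)) (size2 K n)"
    "Z4 R n \<in> carrier_mat (dim_row (Z2 R n)) (size1 K (n + 1))"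
    "Z5 R n \<in> carrier_mat (dim_row (Z2 R n)) (size0 K (n + 2))"
    "orthogonal_matrix_of_size (size1 K n) (S1 R n @\<^sub>r Z1 R n)"
    "orthogonal_matrix_of_size (size2 K n) (S2 R n @\<^sub>r Z2 R n)"
    "Z1 R n * blkB2 K n + Z3 R n * blkC3 K (n + 1) = 0\<^sub>m (dim_row (Z1 R n)) d"
    "Z2 R n * blkA1 K n + Z4 R n * blkB2 K (n + 1) + Z5 R n * blkC3 K (n + 2)
       = 0\<^sub>m (dim_row (Z2 R n)) d"
    "full_row_rank (S1 R n * blkB2 K n)"
    "full_row_rank (S2 R n * blkA1 K n)"
    "no_hidden_redundancy (S1 R n * blkB2 K n) (blkC3 K (n + 1))"
    "no_hidden_redundancy (S2 R n * blkA1 K n) (blkB2 K (n + 1) @\<^sub>r blkC3 K (n + 2))"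
  using assms unfolding admissible_reduction_def by blast+

lemma orthogonal_append_size:
  assumes "S \<in> carrier_mat s r" "Z \<in> carrier_mat z r" "orthogonal_matrix_of_size r (S @\<^sub>r Z)"
  shows "s + z = r"
proof -
  have "S @\<^sub>r Z \<in> carrier_mat r r" using assms(3) unfolding orthogonal_matrix_of_size_def by simp
  moreover have "S @\<^sub>r Z \<in> carrier_mat (s + z) r" using assms(1,2) by auto
  ultimately show ?thesis by (metis carrier_matD(1))
qed

lemma reduction_sizes:
  assumes "admissible_reduction n0 d K R" "n \<ge> n0"
  shows "dim_row (S1 R n) + dim_row (Z1 R n) = size1 K n"
    "dim_row (S2 R n) + dim_row (Z2 R n) = size2 K n"
  using orthogonal_append_size admissible_reductionD[OF assms] by blast+

context
  fixes n0 m d :: nat and E :: side and K :: condensed and R :: reduction and n :: nat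
  assumes E: "side_dims n0 m d E" and K: "is_condensed_form n0 m d E K"
    and R: "admissible_reduction n0 d K R" and n: "n \<ge> n0"
begin

lemma reduced_block_dims:
  "S2 R n * blkA1 K n \<in> carrier_mat (dim_row (S2 R n)) d"
  "S2 R n * blkB1 K n \<in> carrier_mat (dim_row (S2 R n)) d"
  "S2 R n * blkC1 K n \<in> carrier_mat (dim_row (S2 R n)) d"
  "Z2 R n * blkB1 K n + Z4 R n * blkC2 K (n + 1) \<in> carrier_mat (dim_row (Z2 R n)) d"
  "Z2 R n * blkC1 K n \<in> carrier_mat (dim_row (Z2 R n)) d"
  "S1 R n * blkB2 K n \<in> carrier_mat (dim_row (S1 R n)) d"
  "S1 R n * blkC2 K n \<in> carrier_mat (dim_row (S1 R n)) d"
  "Z1 R n * blkC2 K n \<in> carrier_mat (dim_row (Z1 R n)) d"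
  "S2 R n *\<^sub>v rhs1 K n \<in> carrier_vec (dim_row (S2 R n))"
  "Z2 R n *\<^sub>v rhs1 K n + Z4 R n *\<^sub>v rhs2 K (n + 1) + Z5 R n *\<^sub>v rhs3 K (n + 2)
     \<in> carrier_vec (dim_row (Z2 R n))"
  "S1 R n *\<^sub>v rhs2 K n \<in> carrier_vec (dim_row (S1 R n))"
  "Z1 R n *\<^sub>v rhs2 K n + Z3 R n *\<^sub>v rhs3 K (n + 1) \<in> carrier_vec (dim_row (Z1 R n))"
proof -
  note D = condensed_form_dims[OF E K n]
  note D1 = condensed_form_dims[OF E K trans_le_add1[OF n, of 1]]
  note D2 = condensed_form_dims[OF E K trans_le_add1[OF n, of 2]]
  note A = admissible_reductionD[OF R n]
  note mm = mult_carrier_mat and mv = mult_mat_vec_carrier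
  show "S2 R n * blkA1 K n \<in> carrier_mat (dim_row (S2 R n)) d"
    "S2 R n * blkB1 K n \<in> carrier_mat (dim_row (S2 R n)) d"
    "S2 R n * blkC1 K n \<in> carrier_mat (dim_row (S2 R n)) d"
    "Z2 R n * blkC1 K n \<in> carrier_mat (dim_row (Z2 R n)) d"
    "S1 R n * blkB2 K n \<in> carrier_mat (dim_row (S1 R n)) d"
    "S1 R n * blkC2 K n \<in> carrier_mat (dim_row (S1 R n)) d"
    "Z1 R n * blkC2 K n \<in> carrier_mat (dim_row (Z1 R n)) d"
    using mm[OF A(4) D(1)] mm[OF A(4) D(2)] mm[OF A(4) D(3)] mm[OF A(5) D(3)] mm[OF A(1) D(4)]
      mm[OF A(1) D(5)] mm[OF A(2) D(5)] .
  show "Z2 R n * blkB1 K n + Z4 R n * blkC2 K (n + 1) \<in> carrier_mat (dim_row (Z2 R n)) d"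
    by (rule add_carrier_mat[OF mm[OF A(6) D1(5)]])
  show "S2 R n *\<^sub>v rhs1 K n \<in> carrier_vec (dim_row (S2 R n))"
    "S1 R n *\<^sub>v rhs2 K n \<in> carrier_vec (dim_row (S1 R n))"
    using mv[OF A(4) D(7)] mv[OF A(1) D(8)] .
  show "Z2 R n *\<^sub>v rhs1 K n + Z4 R n *\<^sub>v rhs2 K (n + 1) + Z5 R n *\<^sub>v rhs3 K (n + 2)
     \<in> carrier_vec (dim_row (Z2 R n))"
    by (intro add_carrier_vec mv[OF A(5) D(7)] mv[OF A(6) D1(8)] mv[OF A(7) D2(9)])
  show "Z1 R n *\<^sub>v rhs2 K n + Z3 R n *\<^sub>v rhs3 K (n + 1) \<in> carrier_vec (dim_row (Z1 R n))"
    by (intro add_carrier_vec mv[OF A(2) D(8)] mv[OF A(3) D1(9)])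
qed

lemma reduced_side_carriers:
  "coefA (reduced_side m d K R) n \<in> carrier_mat m d" "coefB (reduced_side m d K R) n \<in> carrier_mat m d"
  "coefC (reduced_side m d K R) n \<in> carrier_mat m d" "inhom (reduced_side m d K R) n \<in> carrier_vec m"
proof -
  note D = condensed_form_dims[OF E K n]
  let ?M = "dim_row (S2 R n) + (dim_row (Z2 R n) + (dim_row (S1 R n) + (dim_row (Z1 R n)
      + (size0 K n + sizev m K n))))"
  have m: "?M = m"
    using D(11) reduction_sizes[OF R n] by simp
  note B = reduced_block_dims D(6)
  have "coefA (reduced_side m d K R) n \<in> carrier_mat ?M d" "coefB (reduced_side m d K R) n \<in> carrier_mat ?M d"
    "coefC (reduced_side m d K R) n \<in> carrier_mat ?M d"
    unfolding reduced_side_def side.simps by (intro carrier_append_rows B zero_carrier_mat)+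
  moreover have "inhom (reduced_side m d K R) n \<in> carrier_vec ?M"
    unfolding reduced_side_def side.simps by (intro append_carrier_vec reduced_block_dims(9-12) D(9,10))
  ultimately show "coefA (reduced_side m d K R) n \<in> carrier_mat m d" "coefB (reduced_side m d K R) n \<in> carrier_mat m d"
    "coefC (reduced_side m d K R) n \<in> carrier_mat m d" "inhom (reduced_side m d K R) n \<in> carrier_vec m"
    unfolding m .
qed

text \<open>The six block rows are peeled off one by one. The first four conjuncts are grouped in
  pairs, each in the shape delivered by \<open>top_rows_reduction\<close> and
  \<open>middle_rows_reduction\<close>.\<close>

lemma reduced_equation_iff:
  assumes x: "x (n + 2) \<in> carrier_vec d" "x (n + 1) \<in> carrier_vec d" "x n \<in> carrier_vec d"
  shows "coefA (reduced_side m d K R) n *\<^sub>v x (n + 2) + coefB (reduced_side m d K R) n *\<^sub>v x (n + 1)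
      + coefC (reduced_side m d K R) n *\<^sub>v x n = inhom (reduced_side m d K R) n \<longleftrightarrow>
    ((S2 R n * blkA1 K n) *\<^sub>v x (n + 2) + (S2 R n * blkB1 K n) *\<^sub>v x (n + 1)
       + (S2 R n * blkC1 K n) *\<^sub>v x n = S2 R n *\<^sub>v rhs1 K n \<and>
     (Z2 R n * blkB1 K n + Z4 R n * blkC2 K (n + 1)) *\<^sub>v x (n + 1) + (Z2 R n * blkC1 K n) *\<^sub>v x n
       = Z2 R n *\<^sub>v rhs1 K n + Z4 R n *\<^sub>v rhs2 K (n + 1) + Z5 R n *\<^sub>v rhs3 K (n + 2)) \<and>
    ((S1 R n * blkB2 K n) *\<^sub>v x (n + 1) + (S1 R n * blkC2 K n) *\<^sub>v x n = S1 R n *\<^sub>v rhs2 K n \<and>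
     (Z1 R n * blkC2 K n) *\<^sub>v x n = Z1 R n *\<^sub>v rhs2 K n + Z3 R n *\<^sub>v rhs3 K (n + 1)) \<and>
    blkC3 K n *\<^sub>v x n = rhs3 K n \<and> 0\<^sub>v (sizev m K n) = rhs4 K n"
proof -
  note D = condensed_form_dims[OF E K n]
  note B = reduced_block_dims D(6)
  let ?O = "\<lambda>k. 0\<^sub>m k d :: real mat"
  let ?r = "size0 K n" and ?v = "sizev m K n"
  let ?z1 = "dim_row (Z1 R n)" and ?s1 = "dim_row (S1 R n)" and ?z2 = "dim_row (Z2 R n)"
  note O = zero_carrier_mat[where ?'a = real]
  have l5: "?O ?r @\<^sub>r ?O ?v \<in> carrier_mat (?r + ?v) d" "blkC3 K n @\<^sub>r ?O ?v \<in> carrier_mat (?r + ?v) d"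
    by (intro carrier_append_rows B O)+
  have l4: "?O ?z1 @\<^sub>r ?O ?r @\<^sub>r ?O ?v \<in> carrier_mat (?z1 + (?r + ?v)) d"
    "Z1 R n * blkC2 K n @\<^sub>r blkC3 K n @\<^sub>r ?O ?v \<in> carrier_mat (?z1 + (?r + ?v)) d"
    by (intro carrier_append_rows B O)+
  have l3: "?O ?s1 @\<^sub>r ?O ?z1 @\<^sub>r ?O ?r @\<^sub>r ?O ?v \<in> carrier_mat (?s1 + (?z1 + (?r + ?v))) d"
    "S1 R n * blkB2 K n @\<^sub>r ?O ?z1 @\<^sub>r ?O ?r @\<^sub>r ?O ?v \<in> carrier_mat (?s1 + (?z1 + (?r + ?v))) d"
    "S1 R n * blkC2 K n @\<^sub>r Z1 R n * blkC2 K n @\<^sub>r blkC3 K n @\<^sub>r ?O ?v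
       \<in> carrier_mat (?s1 + (?z1 + (?r + ?v))) d"
    by (intro carrier_append_rows B O)+
  have l2: "?O ?z2 @\<^sub>r ?O ?s1 @\<^sub>r ?O ?z1 @\<^sub>r ?O ?r @\<^sub>r ?O ?v
       \<in> carrier_mat (?z2 + (?s1 + (?z1 + (?r + ?v)))) d"
    "(Z2 R n * blkB1 K n + Z4 R n * blkC2 K (n + 1)) @\<^sub>r S1 R n * blkB2 K n @\<^sub>r ?O ?z1 @\<^sub>r ?O ?r @\<^sub>r ?O ?v
       \<in> carrier_mat (?z2 + (?s1 + (?z1 + (?r + ?v)))) d"
    "Z2 R n * blkC1 K n @\<^sub>r S1 R n * blkC2 K n @\<^sub>r Z1 R n * blkC2 K n @\<^sub>r blkC3 K n @\<^sub>r ?O ?v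
       \<in> carrier_mat (?z2 + (?s1 + (?z1 + (?r + ?v)))) d"
    by (intro carrier_append_rows B O)+
  have z: "0\<^sub>m a d *\<^sub>v x (n + 2) = (0\<^sub>v a :: real vec)" "0\<^sub>m a d *\<^sub>v x (n + 1) = (0\<^sub>v a :: real vec)"
    "0\<^sub>m a d *\<^sub>v x n = (0\<^sub>v a :: real vec)" for a
    using x zero_mat_mult_vec by blast+
  have zl: "0\<^sub>v k + y = y" if "y \<in> carrier_vec k" for k and y :: "real vec"
    using that by simp
  note mc = mult_mat_vec_carrier
  have c: "0\<^sub>v ?z2 + (Z2 R n * blkB1 K n + Z4 R n * blkC2 K (n + 1)) *\<^sub>v x (n + 1)
      = (Z2 R n * blkB1 K n + Z4 R n * blkC2 K (n + 1)) *\<^sub>v x (n + 1)"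
    "0\<^sub>v ?s1 + (S1 R n * blkB2 K n) *\<^sub>v x (n + 1) = (S1 R n * blkB2 K n) *\<^sub>v x (n + 1)"
    "0\<^sub>v ?z1 + (Z1 R n * blkC2 K n) *\<^sub>v x n = (Z1 R n * blkC2 K n) *\<^sub>v x n"
    "0\<^sub>v ?r + blkC3 K n *\<^sub>v x n = blkC3 K n *\<^sub>v x n"
    "\<And>k. 0\<^sub>v k + 0\<^sub>v k = (0\<^sub>v k :: real vec)"
    using zl mc[OF B(4) x(2)] mc[OF B(6) x(2)] mc[OF B(8) x(3)] mc[OF B(13) x(3)] by simp_all
  show ?thesis
    unfolding reduced_side_def side.simps
      append_system_iff[OF B(1-3) l2 x B(9)]
      append_system_iff[OF O B(4,5) l3 x B(10)]
      append_system_iff[OF O B(6,7) l4(1) l4 x B(11)]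
      append_system_iff[OF O O B(8) l5(1) l5 x B(12)]
      append_system_iff[OF O O B(13) O O O x D(9)]
      z c by simp
qed

end

lemma reduced_side_dims:
  assumes "side_dims n0 m d E" "is_condensed_form n0 m d E K" "admissible_reduction n0 d K R"
  shows "side_dims n0 m d (reduced_side m d K R)"
  unfolding side_dims_def using reduced_side_carriers[OF assms] by blast

text \<open>The equation at time \<open>n\<close> also involves \<open>x\<close> at
  \<open>n + 1\<close> and \<open>n + 2\<close>. Rewriting it under the quantifier therefore needs
  the guard \<open>c\<close> at all times, not just at \<open>n\<close>.\<close>

lemma guarded_all_conj_cong:
  fixes n0 :: nat
  assumes "\<And>n. n \<ge> n0 \<Longrightarrow> \<forall>n\<ge>n0. c n \<Longrightarrow> p n = q n"
  shows "(\<forall>n\<ge>n0. c n \<and> p n) \<longleftrightarrow> (\<forall>n\<ge>n0. c n) \<and> (\<forall>n\<ge>n0. q n)"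
  using assms by blast

lemma solution_set_reduced:
  assumes E: "side_dims n0 m d E" and K: "is_condensed_form n0 m d E K"
    and R: "admissible_reduction n0 d K R"
    and v: "\<And>n. n \<ge> n0 \<Longrightarrow> sizev m K n = s"
  shows "solution_set n0 d (reduced_side m d K R) = solution_set n0 d E"
proof -
  let ?P1 = "\<lambda>x n. blkA1 K n *\<^sub>v x (n + 2) + blkB1 K n *\<^sub>v x (n + 1) + blkC1 K n *\<^sub>v x n = rhs1 K n"
  let ?P2 = "\<lambda>x n. blkB2 K n *\<^sub>v x (n + 1) + blkC2 K n *\<^sub>v x n = rhs2 K n"
  let ?P3 = "\<lambda>x n. blkC3 K n *\<^sub>v x n = rhs3 K n"
  let ?Q1 = "\<lambda>x n. (S2 R n * blkA1 K n) *\<^sub>v x (n + 2) + (S2 R n * blkB1 K n) *\<^sub>v x (n + 1)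
       + (S2 R n * blkC1 K n) *\<^sub>v x n = S2 R n *\<^sub>v rhs1 K n \<and>
     (Z2 R n * blkB1 K n + Z4 R n * blkC2 K (n + 1)) *\<^sub>v x (n + 1) + (Z2 R n * blkC1 K n) *\<^sub>v x n
       = Z2 R n *\<^sub>v rhs1 K n + Z4 R n *\<^sub>v rhs2 K (n + 1) + Z5 R n *\<^sub>v rhs3 K (n + 2)"
  let ?Q2 = "\<lambda>x n. (S1 R n * blkB2 K n) *\<^sub>v x (n + 1) + (S1 R n * blkC2 K n) *\<^sub>v x n = S1 R n *\<^sub>v rhs2 K n \<and>
     (Z1 R n * blkC2 K n) *\<^sub>v x n = Z1 R n *\<^sub>v rhs2 K n + Z3 R n *\<^sub>v rhs3 K (n + 1)"
  have "(\<forall>n\<ge>n0. ?Q1 x n \<and> ?Q2 x n \<and> ?P3 x n \<and> 0\<^sub>v s = rhs4 K n) \<longleftrightarrow>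
      (\<forall>n\<ge>n0. ?P1 x n \<and> ?P2 x n \<and> ?P3 x n \<and> 0\<^sub>v s = rhs4 K n)"
    if xc: "\<And>n. n \<ge> n0 \<Longrightarrow> x n \<in> carrier_vec d" for x
  proof -
    \<comment> \<open>Both equivalences are conditional on equations lower in the staircase at later
      times. The bottom equation is common to the two systems, so neither direction is
      circular.\<close>
    have Q2: "?P2 x n = ?Q2 x n" if n: "n \<ge> n0" and p: "?P3 x (n + 1)" for n
      by (rule middle_rows_reduction[OF admissible_reductionD(1,2,8)[OF R n]
          condensed_form_dims(4,5)[OF E K n] admissible_reductionD(3)[OF R n]
          condensed_form_dims(6)[OF E K] admissible_reductionD(10)[OF R n] xc xc
          condensed_form_dims(8)[OF E K n] p]) (use n in auto)
    have Q1: "?P1 x n = ?Q1 x n" if n: "n \<ge> n0" and p: "?P2 x (n + 1)" "?P3 x (n + 2)" for n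
    proof -
      \<comment> \<open>The middle equation at \<open>n + 1\<close> literally speaks of
        \<open>x (n + 1 + 1)\<close>.\<close>
      have p': "blkB2 K (n + 1) *\<^sub>v x (n + 2) + blkC2 K (n + 1) *\<^sub>v x (n + 1) = rhs2 K (n + 1)"
        using p(1) by (simp add: numeral_2_eq_2)
      show ?thesis
        by (rule top_rows_reduction[OF admissible_reductionD(4,5,9)[OF R n]
            condensed_form_dims(1-3)[OF E K n] admissible_reductionD(6)[OF R n]
            condensed_form_dims(4,5)[OF E K] admissible_reductionD(7)[OF R n]
            condensed_form_dims(6)[OF E K] admissible_reductionD(11)[OF R n] xc xc xc
            condensed_form_dims(7)[OF E K n] p' p(2)]) (use n in auto)
    qed
    show ?thesis
    proof (intro iffI allI impI)
      fix n assume Q: "\<forall>n\<ge>n0. ?Q1 x n \<and> ?Q2 x n \<and> ?P3 x n \<and> 0\<^sub>v s = rhs4 K n" and n: "n \<ge> n0"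
      have P3: "?P3 x k" if "k \<ge> n0" for k using Q that by blast
      have P2: "?P2 x k" if k: "k \<ge> n0" for k
        using Q2[OF k P3] Q k by simp
      have "?P1 x n" using Q1[OF n P2 P3] Q n by simp
      then show "?P1 x n \<and> ?P2 x n \<and> ?P3 x n \<and> 0\<^sub>v s = rhs4 K n"
        using P2[OF n] P3[OF n] Q n by blast
    next
      fix n assume P: "\<forall>n\<ge>n0. ?P1 x n \<and> ?P2 x n \<and> ?P3 x n \<and> 0\<^sub>v s = rhs4 K n" and n: "n \<ge> n0"
      have P3: "?P3 x k" and P2: "?P2 x k" if "k \<ge> n0" for k using P that by blast+
      have "?Q2 x n" using Q2[OF n P3] P2[OF n] n by simp
      moreover have "?Q1 x n" using Q1[OF n P2 P3] P n by simp
      ultimately show "?Q1 x n \<and> ?Q2 x n \<and> ?P3 x n \<and> 0\<^sub>v s = rhs4 K n"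
        using P3[OF n] P n by blast
    qed
  qed
  then have PQ: "(\<forall>n\<ge>n0. x n \<in> carrier_vec d) \<and> (\<forall>n\<ge>n0. ?Q1 x n \<and> ?Q2 x n \<and> ?P3 x n \<and> 0\<^sub>v s = rhs4 K n) \<longleftrightarrow>
      (\<forall>n\<ge>n0. x n \<in> carrier_vec d) \<and> (\<forall>n\<ge>n0. ?P1 x n \<and> ?P2 x n \<and> ?P3 x n \<and> 0\<^sub>v s = rhs4 K n)" for x
    by (rule conj_cong[OF refl]) simp
  have reduced: "x \<in> solution_set n0 d (reduced_side m d K R) \<longleftrightarrow>
      (\<forall>n\<ge>n0. x n \<in> carrier_vec d) \<and> (\<forall>n\<ge>n0. ?Q1 x n \<and> ?Q2 x n \<and> ?P3 x n \<and> 0\<^sub>v s = rhs4 K n)" for x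
    \<comment> \<open>The zero rows of the reduced system have size \<open>sizev m K n\<close>, for
      which the common value \<open>s\<close> has to be exchanged.\<close>
    unfolding solution_set_def mem_Collect_eq
    by (rule guarded_all_conj_cong, subst v[symmetric], assumption,
        rule reduced_equation_iff[OF E K R]) auto
  have sol: "solution_set n0 d E = staircase_solutions n0 d K (rhs1 K) (rhs2 K) (rhs3 K) (rhs4 K) s"
    by (rule solution_set_condensed[OF E K]) (rule v)
  have original: "x \<in> solution_set n0 d E \<longleftrightarrow>
      (\<forall>n\<ge>n0. x n \<in> carrier_vec d) \<and> (\<forall>n\<ge>n0. ?P1 x n \<and> ?P2 x n \<and> ?P3 x n \<and> 0\<^sub>v s = rhs4 K n)" for x
    unfolding sol staircase_solutions_def mem_Collect_eq
    by (rule guarded_all_conj_cong) (rule refl)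
  show ?thesis
  proof (rule Set.set_eqI)
    fix x
    show "x \<in> solution_set n0 d (reduced_side m d K R) \<longleftrightarrow> x \<in> solution_set n0 d E"
      unfolding reduced original by (rule PQ)
  qed
qed

subsection \<open>Decrease of the block sizes\<close>

lemma condensed_coefs:
  assumes "is_condensed_form n0 m d E K" "n \<ge> n0"
  shows "scaling K n * coefA E n
      = blkA1 K n @\<^sub>r 0\<^sub>m (size1 K n) d @\<^sub>r 0\<^sub>m (size0 K n) d @\<^sub>r 0\<^sub>m (sizev m K n) d"
    "scaling K n * coefB E n
      = blkB1 K n @\<^sub>r blkB2 K n @\<^sub>r 0\<^sub>m (size0 K n) d @\<^sub>r 0\<^sub>m (sizev m K n) d"
    "scaling K n * coefC E n
      = blkC1 K n @\<^sub>r blkC2 K n @\<^sub>r blkC3 K n @\<^sub>r 0\<^sub>m (sizev m K n) d"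
    "scaling K n \<in> carrier_mat m m"
    "full_row_rank (blkA1 K n)" "full_row_rank (blkB2 K n)" "full_row_rank (blkC3 K n)"
  using assms unfolding is_condensed_form_def same_side_def scaled_side_def block_side_def
    nonsingular_def by auto

text \<open>One selector serves all matrices of the shape: both leading coefficients have to be cut
  by the same \<open>F\<close>, because \<open>staircase_row_bound\<close> demands a common left
  factor.\<close>

lemma drop_zero_rows:
  "\<exists>F \<in> carrier_mat a (a + z). \<forall>A \<in> carrier_mat a d. F * (A @\<^sub>r 0\<^sub>m z d) = (A :: real mat)"
proof (intro bexI ballI)
  show "four_block_mat (1\<^sub>m a) (0\<^sub>m a z) (0\<^sub>m 0 a) (0\<^sub>m 0 z) \<in> carrier_mat a (a + z)"
    using four_block_carrier_mat[of "1\<^sub>m a" a a "0\<^sub>m 0 z" 0 z] by simp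
qed (rule top_rows_selector[OF _ zero_carrier_mat])

context
  fixes n0 m d :: nat and E :: side and K K' :: condensed and R :: reduction and n :: nat
  assumes E: "side_dims n0 m d E" and K: "is_condensed_form n0 m d E K"
    and R: "admissible_reduction n0 d K R"
    and K': "is_condensed_form n0 m d (reduced_side m d K R) K'" and n: "n \<ge> n0"
begin

text \<open>Vanishing rows are absorbed by a zero block of the left factor. \<open>coefA\<close>
  appears twice: alone it needs only its \<open>S2\<close> rows, but for joint treatment with
  \<open>coefB\<close> it keeps zero rows in place of \<open>Z2\<close> and \<open>S1\<close>, so
  that the two left factors agree.\<close>

lemma reduced_coef_factors:
  "coefA (reduced_side m d K R) n = (1\<^sub>m (dim_row (S2 R n))
     @\<^sub>r 0\<^sub>m (dim_row (Z2 R n) + (dim_row (S1 R n) + (dim_row (Z1 R n) + (size0 K n + sizev m K n))))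
         (dim_row (S2 R n))) * (S2 R n * blkA1 K n)"
  "coefA (reduced_side m d K R) n = (1\<^sub>m (dim_row (S2 R n) + (dim_row (Z2 R n) + dim_row (S1 R n)))
     @\<^sub>r 0\<^sub>m (dim_row (Z1 R n) + (size0 K n + sizev m K n))
         (dim_row (S2 R n) + (dim_row (Z2 R n) + dim_row (S1 R n))))
     * (S2 R n * blkA1 K n @\<^sub>r 0\<^sub>m (dim_row (Z2 R n)) d @\<^sub>r 0\<^sub>m (dim_row (S1 R n)) d)"
  "coefB (reduced_side m d K R) n = (1\<^sub>m (dim_row (S2 R n) + (dim_row (Z2 R n) + dim_row (S1 R n)))
     @\<^sub>r 0\<^sub>m (dim_row (Z1 R n) + (size0 K n + sizev m K n))
         (dim_row (S2 R n) + (dim_row (Z2 R n) + dim_row (S1 R n))))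
     * (S2 R n * blkB1 K n @\<^sub>r (Z2 R n * blkB1 K n + Z4 R n * blkC2 K (n + 1)) @\<^sub>r S1 R n * blkB2 K n)"
proof -
  note B = reduced_block_dims[OF E K R n]
  note O = zero_carrier_mat[where ?'a = real]
  note c = carrier_append_rows
  show "coefA (reduced_side m d K R) n = (1\<^sub>m (dim_row (S2 R n))
     @\<^sub>r 0\<^sub>m (dim_row (Z2 R n) + (dim_row (S1 R n) + (dim_row (Z1 R n) + (size0 K n + sizev m K n))))
         (dim_row (S2 R n))) * (S2 R n * blkA1 K n)"
    unfolding reduced_side_def side.simps append_rows_zero append_zero_rows_factor[OF B(1)] ..
  show "coefA (reduced_side m d K R) n = (1\<^sub>m (dim_row (S2 R n) + (dim_row (Z2 R n) + dim_row (S1 R n)))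
     @\<^sub>r 0\<^sub>m (dim_row (Z1 R n) + (size0 K n + sizev m K n))
         (dim_row (S2 R n) + (dim_row (Z2 R n) + dim_row (S1 R n))))
     * (S2 R n * blkA1 K n @\<^sub>r 0\<^sub>m (dim_row (Z2 R n)) d @\<^sub>r 0\<^sub>m (dim_row (S1 R n)) d)"
    unfolding reduced_side_def side.simps append_rows_zero
      append_zero_rows_factor[OF c[OF B(1) O], symmetric] append_rows_assoc[OF B(1) O O]
    by (simp add: add.assoc)
  show "coefB (reduced_side m d K R) n = (1\<^sub>m (dim_row (S2 R n) + (dim_row (Z2 R n) + dim_row (S1 R n)))
     @\<^sub>r 0\<^sub>m (dim_row (Z1 R n) + (size0 K n + sizev m K n))
         (dim_row (S2 R n) + (dim_row (Z2 R n) + dim_row (S1 R n))))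
     * (S2 R n * blkB1 K n @\<^sub>r (Z2 R n * blkB1 K n + Z4 R n * blkC2 K (n + 1)) @\<^sub>r S1 R n * blkB2 K n)"
    unfolding reduced_side_def side.simps append_rows_zero
      append_zero_rows_factor[OF c[OF B(2) c[OF B(4,6)]], symmetric]
      append_rows_assoc[OF B(2) c[OF B(4,6)] O] append_rows_assoc[OF B(4,6) O] ..
qed

text \<open>Outside the \<open>S2\<close> rows the new leading coefficient vanishes, so whatever row
  operations extract from it factors through \<open>dim_row (S2 R n)\<close> columns. The extracted
  block \<open>blkA1 K' n\<close> has full row rank.\<close>

lemma size2_reduced_le: "size2 K' n \<le> dim_row (S2 R n)"
proof -
  let ?E' = "reduced_side m d K R"
  let ?s = "dim_row (S2 R n)"
  let ?z = "dim_row (Z2 R n) + (dim_row (S1 R n) + (dim_row (Z1 R n) + (size0 K n + sizev m K n)))"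
  let ?X = "1\<^sub>m ?s @\<^sub>r 0\<^sub>m ?z ?s :: real mat"
  note E' = reduced_side_dims[OF E K R]
  note D' = condensed_form_dims[OF E' K' n] and C' = condensed_coefs[OF K' n]
  note B = reduced_block_dims[OF E K R n]
  let ?w = "size1 K' n + (size0 K' n + sizev m K' n)"
  have m: "size2 K' n + ?w = m" using D'(11) by simp
  obtain F :: "real mat" where F: "F \<in> carrier_mat (size2 K' n) (size2 K' n + ?w)"
    "\<And>A. A \<in> carrier_mat (size2 K' n) d \<Longrightarrow> F * (A @\<^sub>r 0\<^sub>m ?w d) = A"
    using drop_zero_rows[of "size2 K' n" ?w d] by blast
  have Fm: "F \<in> carrier_mat (size2 K' n) m" using F(1) m by simp
  have "dim_row (coefA ?E' n) = m" using reduced_side_carriers(1)[OF E K R n] by simp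
  then have "?s + ?z = m"
    unfolding reduced_coef_factors(1) by (simp add: append_rows_def)
  then have X: "?X \<in> carrier_mat m ?s" using carrier_append_rows[of "1\<^sub>m ?s" ?s ?s "0\<^sub>m ?z ?s" ?z] by simp
  have "blkA1 K' n = F * (scaling K' n * coefA ?E' n)"
    using F(2)[OF D'(1)] C'(1) by (simp add: append_rows_zero)
  also have "\<dots> = F * (scaling K' n * ?X) * (S2 R n * blkA1 K n)"
    unfolding reduced_coef_factors(1) assoc_mult_mat[OF C'(4) X B(1), symmetric]
    using assoc_mult_mat[OF Fm mult_carrier_mat[OF C'(4) X] B(1)] by simp
  finally show ?thesis
    using full_row_rank_row_bound[OF D'(1) C'(5) mult_carrier_mat[OF Fm mult_carrier_mat[OF C'(4) X]] B(1)]
    by simp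
qed

text \<open>The \<open>Z1\<close> rows no longer contribute to \<open>coefB\<close>, which is the
  effect of the elimination. The upper blocks of the new condensed form are the staircase of
  \<open>staircase_row_bound\<close>, and \<open>S2\<close> and \<open>Z2\<close> together have
  \<open>size2 K n\<close> rows.\<close>

lemma size21_reduced_le: "size2 K' n + size1 K' n \<le> dim_row (S2 R n) + (dim_row (Z2 R n) + dim_row (S1 R n))"
proof -
  let ?E' = "reduced_side m d K R"
  let ?s = "dim_row (S2 R n) + (dim_row (Z2 R n) + dim_row (S1 R n))"
  let ?z = "dim_row (Z1 R n) + (size0 K n + sizev m K n)"
  let ?X = "1\<^sub>m ?s @\<^sub>r 0\<^sub>m ?z ?s :: real mat"
  let ?T = "S2 R n * blkA1 K n @\<^sub>r 0\<^sub>m (dim_row (Z2 R n)) d @\<^sub>r 0\<^sub>m (dim_row (S1 R n)) d"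
  let ?T' = "S2 R n * blkB1 K n @\<^sub>r (Z2 R n * blkB1 K n + Z4 R n * blkC2 K (n + 1)) @\<^sub>r S1 R n * blkB2 K n"
  note E' = reduced_side_dims[OF E K R]
  note D' = condensed_form_dims[OF E' K' n] and C' = condensed_coefs[OF K' n]
  note B = reduced_block_dims[OF E K R n]
  note O = zero_carrier_mat[where ?'a = real]
  have T: "?T \<in> carrier_mat ?s d" "?T' \<in> carrier_mat ?s d"
    by (intro carrier_append_rows B O)+
  let ?b = "size2 K' n + size1 K' n"
  let ?w = "size0 K' n + sizev m K' n"
  have m: "?b + ?w = m" using D'(11) by simp
  have top: "blkA1 K' n @\<^sub>r 0\<^sub>m (size1 K' n) d \<in> carrier_mat ?b d"
    "blkB1 K' n @\<^sub>r blkB2 K' n \<in> carrier_mat ?b d"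
    by (intro carrier_append_rows D' O)+
  obtain F :: "real mat" where F: "F \<in> carrier_mat ?b (?b + ?w)"
    "\<And>A. A \<in> carrier_mat ?b d \<Longrightarrow> F * (A @\<^sub>r 0\<^sub>m ?w d) = A"
    using drop_zero_rows[of ?b ?w d] by blast
  have Fm: "F \<in> carrier_mat ?b m" using F(1) m by simp
  have "dim_row (coefA ?E' n) = m" using reduced_side_carriers(1)[OF E K R n] by simp
  then have "?s + ?z = m"
    unfolding reduced_coef_factors(2) by (simp add: append_rows_def)
  then have X: "?X \<in> carrier_mat m ?s" using carrier_append_rows[of "1\<^sub>m ?s" ?s ?s "0\<^sub>m ?z ?s" ?z] by simp
  have PX: "scaling K' n * ?X \<in> carrier_mat m ?s" using mult_carrier_mat[OF C'(4) X] .
  have "blkA1 K' n @\<^sub>r 0\<^sub>m (size1 K' n) d = F * (scaling K' n * coefA ?E' n)"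
    unfolding C'(1) append_rows_zero[of "size0 K' n"] append_rows_assoc[OF D'(1) O O, symmetric]
      F(2)[OF top(1)] ..
  also have "\<dots> = F * (scaling K' n * ?X) * ?T"
    unfolding reduced_coef_factors(2) assoc_mult_mat[OF C'(4) X T(1), symmetric]
    using assoc_mult_mat[OF Fm PX T(1)] by simp
  finally have 1: "blkA1 K' n @\<^sub>r 0\<^sub>m (size1 K' n) d = F * (scaling K' n * ?X) * ?T" .
  have "blkB1 K' n @\<^sub>r blkB2 K' n = F * (scaling K' n * coefB ?E' n)"
    unfolding C'(2) append_rows_zero append_rows_assoc[OF D'(2,4) O, symmetric] F(2)[OF top(2)] ..
  also have "\<dots> = F * (scaling K' n * ?X) * ?T'"
    unfolding reduced_coef_factors(3) assoc_mult_mat[OF C'(4) X T(2), symmetric]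
    using assoc_mult_mat[OF Fm PX T(2)] by simp
  finally have 2: "blkB1 K' n @\<^sub>r blkB2 K' n = F * (scaling K' n * ?X) * ?T'" .
  show ?thesis
    by (rule staircase_row_bound[OF D'(1) C'(5) D'(2) D'(4) C'(6) mult_carrier_mat[OF Fm PX] T 1 2])
qed

end

text \<open>Sizes are compared at \<open>n0\<close>, whereas the stopping condition speaks of all
  times. Constancy of the sizes carries a failure to decrease from \<open>n0\<close> to every
  \<open>n\<close>.\<close>

lemma size_decreases:
  assumes E: "side_dims n0 m d E" and K: "is_condensed_form n0 m d E K"
    and cr: "constant_rank_assumption n0 K" and ns: "\<not> stopping_condition n0 K"
    and R: "admissible_reduction n0 d K R"
    and K': "is_condensed_form n0 m d (reduced_side m d K R) K'"
    and cr': "constant_rank_assumption n0 K'"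
  shows "size2 K' n0 < size2 K n0 \<or> size2 K' n0 = size2 K n0 \<and> size1 K' n0 < size1 K n0"
proof (rule disjCI)
  assume "\<not> (size2 K' n0 = size2 K n0 \<and> size1 K' n0 < size1 K n0)"
  have const: "size2 K n = size2 K n0" "size1 K n = size1 K n0"
    "size2 K' n = size2 K' n0" "size1 K' n = size1 K' n0" if "n \<ge> n0" for n
    using cr cr' that unfolding constant_rank_assumption_def by auto
  note sizes = reduction_sizes[OF R] and AR = admissible_reductionD[OF R]
  show "size2 K' n0 < size2 K n0"
  proof (rule ccontr)
    assume nl: "\<not> size2 K' n0 < size2 K n0"
    have s2: "dim_row (S2 R n) = size2 K n" and z2: "dim_row (Z2 R n) = 0"
      and eq2: "size2 K' n = size2 K n" if n: "n \<ge> n0" for n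
      using size2_reduced_le[OF E K R K' n] sizes(2)[OF n] nl const[OF n] by auto
    have "size1 K' n0 \<ge> size1 K n0"
      using \<open>\<not> (_ \<and> _)\<close> eq2[of n0] by auto
    then have s1: "dim_row (S1 R n) = size1 K n" and z1: "dim_row (Z1 R n) = 0" if n: "n \<ge> n0" for n
      using size21_reduced_le[OF E K R K' n] sizes(1)[OF n] s2[OF n] z2[OF n] eq2[OF n] const[OF n]
      by auto
    have "stopping_condition n0 K"
      unfolding stopping_condition_def
    proof (intro allI impI conjI)
      fix n assume n: "n \<ge> n0"
      note D = condensed_form_dims[OF E K n]
      note D1 = condensed_form_dims[OF E K trans_le_add1[OF n, of 1]]
      note D2 = condensed_form_dims[OF E K trans_le_add1[OF n, of 2]]
      have S2: "S2 R n \<in> carrier_mat (size2 K n) (size2 K n)" using AR(4)[OF n] s2[OF n] by simp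
      \<comment> \<open>Without \<open>Z2\<close> rows, orthogonality of the stacked matrix makes
        the transpose of \<open>S2 R n\<close> a left inverse, which allows \<open>S2 R n\<close> to
        be cancelled.\<close>
      have "S2 R n @\<^sub>r Z2 R n = S2 R n"
        using append_rows_empty[OF S2] AR(5)[OF n] z2[OF n] by simp
      then have Q2: "(S2 R n)\<^sup>T * S2 R n = 1\<^sub>m (size2 K n)"
        using AR(9)[OF n] unfolding orthogonal_matrix_of_size_def by simp
      show "no_hidden_redundancy (blkA1 K n) (blkB2 K (n + 1) @\<^sub>r blkC3 K (n + 2))"
        using no_hidden_redundancy_cancel_left[OF S2 _ Q2 D(1) carrier_append_rows[OF D1(4) D2(6)] AR(15)[OF n]]
          S2 by simp
      have S1: "S1 R n \<in> carrier_mat (size1 K n) (size1 K n)" using AR(1)[OF n] s1[OF n] by simp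
      have "S1 R n @\<^sub>r Z1 R n = S1 R n"
        using append_rows_empty[OF S1] AR(2)[OF n] z1[OF n] by simp
      then have Q1: "(S1 R n)\<^sup>T * S1 R n = 1\<^sub>m (size1 K n)"
        using AR(8)[OF n] unfolding orthogonal_matrix_of_size_def by simp
      show "no_hidden_redundancy (blkB2 K n) (blkC3 K (n + 1))"
        using no_hidden_redundancy_cancel_left[OF S1 _ Q1 D(4) D1(6) AR(14)[OF n]] S1 by simp
    qed
    then show False using ns by contradiction
  qed
qed

subsection \<open>Windows of the inhomogeneity\<close>

text \<open>The argument is a map on inhomogeneities, so that \<open>G\<close> can be quantified
  before \<open>h\<close> and closure under the operations of a reduction step can be stated. It
  concerns one time \<open>n\<close>; the coefficients of different times are assembled only at the
  end.\<close>

definition window_map :: "nat \<Rightarrow> nat \<Rightarrow> nat \<Rightarrow> nat \<Rightarrow> nat \<Rightarrow> ((nat \<Rightarrow> real vec) \<Rightarrow> real vec) \<Rightarrow> bool" where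
  "window_map n0 m s N n \<phi> \<longleftrightarrow> (\<exists>G. (\<forall>k\<le>N. G k \<in> carrier_mat s m) \<and>
     (\<forall>h. (\<forall>n\<ge>n0. h n \<in> carrier_vec m) \<longrightarrow> \<phi> h = vec s (\<lambda>i. \<Sum>k\<le>N. (G k *\<^sub>v h (n + k)) $ i)))"

lemma window_map_at:
  assumes "n \<ge> n0"
  shows "window_map n0 m m 0 n (\<lambda>h. h n)"
  unfolding window_map_def
  by (intro exI[of _ "\<lambda>_. 1\<^sub>m m"]) (use assms in \<open>auto intro!: eq_vecI\<close>)

lemma window_map_carrier:
  assumes "window_map n0 m s N n \<phi>" "\<And>n. n \<ge> n0 \<Longrightarrow> h n \<in> carrier_vec m"
  shows "\<phi> h \<in> carrier_vec s"
  using assms unfolding window_map_def by fastforce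

text \<open>A window starting at \<open>n + j\<close> is part of a longer one starting at
  \<open>n\<close>; the additional coefficients are zero.\<close>

lemma window_map_shift:
  assumes n: "n \<ge> n0" and w: "window_map n0 m s N (n + j) \<phi>" and N': "N + j \<le> N'"
  shows "window_map n0 m s N' n \<phi>"
proof -
  obtain G where G: "\<And>k. k \<le> N \<Longrightarrow> G k \<in> carrier_mat s m"
    and \<phi>: "\<And>h. (\<forall>n\<ge>n0. h n \<in> carrier_vec m) \<Longrightarrow> \<phi> h = vec s (\<lambda>i. \<Sum>k\<le>N. (G k *\<^sub>v h (n + j + k)) $ i)"
    using w unfolding window_map_def by blast
  \<comment> \<open>The guard \<open>j \<le> k\<close> matters: truncated subtraction would
    otherwise put \<open>G 0\<close> at the times before \<open>n + j\<close>.\<close>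
  define G' where "G' k = (if j \<le> k \<and> k \<le> j + N then G (k - j) else 0\<^sub>m s m)" for k
  have "(\<Sum>k\<le>N'. (G' k *\<^sub>v h (n + k)) $ i) = (\<Sum>k\<le>N. (G k *\<^sub>v h (n + j + k)) $ i)"
    if h: "\<forall>n\<ge>n0. h n \<in> carrier_vec m" and i: "i < s" for h i
  proof -
    have hc: "h (n + k) \<in> carrier_vec m" for k using h n by simp
    have "(\<Sum>k\<le>N'. (G' k *\<^sub>v h (n + k)) $ i) = (\<Sum>k\<in>{j..j + N}. (G' k *\<^sub>v h (n + k)) $ i)"
    proof (rule sum.mono_neutral_right)
      show "\<forall>k\<in>{..N'} - {j..j + N}. (G' k *\<^sub>v h (n + k)) $ i = 0"
        unfolding G'_def using zero_mat_mult_vec[OF hc] i by auto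
    qed (use N' in auto)
    also have "\<dots> = (\<Sum>k\<le>N. (G' (j + k) *\<^sub>v h (n + (j + k))) $ i)"
      by (rule sum.reindex_bij_witness[of _ "\<lambda>k. j + k" "\<lambda>k. k - j"]) auto
    also have "\<dots> = (\<Sum>k\<le>N. (G k *\<^sub>v h (n + j + k)) $ i)"
      by (rule sum.cong) (auto simp: G'_def add.assoc)
    finally show ?thesis .
  qed
  then have "\<forall>h. (\<forall>n\<ge>n0. h n \<in> carrier_vec m) \<longrightarrow> \<phi> h = vec s (\<lambda>i. \<Sum>k\<le>N'. (G' k *\<^sub>v h (n + k)) $ i)"
    using \<phi> by (auto intro!: eq_vecI)
  moreover have "\<forall>k\<le>N'. G' k \<in> carrier_mat s m" unfolding G'_def using G by auto
  ultimately show ?thesis unfolding window_map_def by blast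
qed

text \<open>The new coefficients are \<open>M * G k\<close>, and the claim amounts to exchanging two
  finite sums.\<close>

lemma window_map_mult:
  assumes n: "n \<ge> n0" and M: "M \<in> carrier_mat t s" and w: "window_map n0 m s N n \<phi>"
  shows "window_map n0 m t N n (\<lambda>h. M *\<^sub>v \<phi> h)"
proof -
  obtain G where G: "\<And>k. k \<le> N \<Longrightarrow> G k \<in> carrier_mat s m"
    and \<phi>: "\<And>h. (\<forall>n\<ge>n0. h n \<in> carrier_vec m) \<Longrightarrow> \<phi> h = vec s (\<lambda>i. \<Sum>k\<le>N. (G k *\<^sub>v h (n + k)) $ i)"
    using w unfolding window_map_def by blast
  have "M *\<^sub>v \<phi> h = vec t (\<lambda>i. \<Sum>k\<le>N. ((M * G k) *\<^sub>v h (n + k)) $ i)"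
    if h: "\<forall>n\<ge>n0. h n \<in> carrier_vec m" for h
  proof (rule eq_vecI)
    fix i assume "i < dim_vec (vec t (\<lambda>i. \<Sum>k\<le>N. ((M * G k) *\<^sub>v h (n + k)) $ i))"
    then have i: "i < t" by simp
    have hc: "h (n + k) \<in> carrier_vec m" for k using h n by simp
    have "((M * G k) *\<^sub>v h (n + k)) $ i = (\<Sum>l<s. M $$ (i, l) * (G k *\<^sub>v h (n + k)) $ l)" if "k \<le> N" for k
      unfolding assoc_mult_mat_vec[OF M G[OF that] hc] using i M G[OF that] hc
      by (auto simp: scalar_prod_def lessThan_atLeast0 intro!: sum.cong)
    then have "(\<Sum>k\<le>N. ((M * G k) *\<^sub>v h (n + k)) $ i)
        = (\<Sum>k\<le>N. \<Sum>l<s. M $$ (i, l) * (G k *\<^sub>v h (n + k)) $ l)" by simp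
    also have "\<dots> = (\<Sum>l<s. M $$ (i, l) * (\<Sum>k\<le>N. (G k *\<^sub>v h (n + k)) $ l))"
      unfolding sum_distrib_left by (rule sum.swap)
    also have "\<dots> = (M *\<^sub>v \<phi> h) $ i"
      unfolding \<phi>[OF h] using i M by (auto simp: scalar_prod_def lessThan_atLeast0 intro!: sum.cong)
    finally show "(M *\<^sub>v \<phi> h) $ i = vec t (\<lambda>i. \<Sum>k\<le>N. ((M * G k) *\<^sub>v h (n + k)) $ i) $ i"
      using i by simp
  qed (use M in simp)
  moreover have "\<forall>k\<le>N. M * G k \<in> carrier_mat t m" using M G by auto
  ultimately show ?thesis unfolding window_map_def by (intro exI[of _ "\<lambda>k. M * G k"]) simp
qed

lemma window_map_add:
  assumes n: "n \<ge> n0" and "window_map n0 m s N n \<phi>" and "window_map n0 m s N n \<psi>"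
  shows "window_map n0 m s N n (\<lambda>h. \<phi> h + \<psi> h)"
proof -
  obtain G where G: "\<And>k. k \<le> N \<Longrightarrow> G k \<in> carrier_mat s m"
    and \<phi>: "\<And>h. (\<forall>n\<ge>n0. h n \<in> carrier_vec m) \<Longrightarrow> \<phi> h = vec s (\<lambda>i. \<Sum>k\<le>N. (G k *\<^sub>v h (n + k)) $ i)"
    using assms(2) unfolding window_map_def by blast
  obtain F where F: "\<And>k. k \<le> N \<Longrightarrow> F k \<in> carrier_mat s m"
    and \<psi>: "\<And>h. (\<forall>n\<ge>n0. h n \<in> carrier_vec m) \<Longrightarrow> \<psi> h = vec s (\<lambda>i. \<Sum>k\<le>N. (F k *\<^sub>v h (n + k)) $ i)"
    using assms(3) unfolding window_map_def by blast
  have "\<phi> h + \<psi> h = vec s (\<lambda>i. \<Sum>k\<le>N. ((G k + F k) *\<^sub>v h (n + k)) $ i)"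
    if h: "\<forall>n\<ge>n0. h n \<in> carrier_vec m" for h
  proof -
    have "((G k + F k) *\<^sub>v h (n + k)) $ i = (G k *\<^sub>v h (n + k)) $ i + (F k *\<^sub>v h (n + k)) $ i"
      if "k \<le> N" "i < s" for k i
      using add_mult_distrib_mat_vec[OF G[OF that(1)] F[OF that(1)], of "h (n + k)"] G[of k] F[of k] that h n by simp
    then show ?thesis unfolding \<phi>[OF h] \<psi>[OF h] by (auto simp: sum.distrib intro!: eq_vecI)
  qed
  moreover have "\<forall>k\<le>N. G k + F k \<in> carrier_mat s m" using F by auto
  ultimately show ?thesis unfolding window_map_def by (intro exI[of _ "\<lambda>k. G k + F k"]) simp
qed

lemma window_map_append:
  assumes n: "n \<ge> n0" and "window_map n0 m s N n \<phi>" and "window_map n0 m t N n \<psi>"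
  shows "window_map n0 m (s + t) N n (\<lambda>h. \<phi> h @\<^sub>v \<psi> h)"
proof -
  obtain G where G: "\<And>k. k \<le> N \<Longrightarrow> G k \<in> carrier_mat s m"
    and \<phi>: "\<And>h. (\<forall>n\<ge>n0. h n \<in> carrier_vec m) \<Longrightarrow> \<phi> h = vec s (\<lambda>i. \<Sum>k\<le>N. (G k *\<^sub>v h (n + k)) $ i)"
    using assms(2) unfolding window_map_def by blast
  obtain F where F: "\<And>k. k \<le> N \<Longrightarrow> F k \<in> carrier_mat t m"
    and \<psi>: "\<And>h. (\<forall>n\<ge>n0. h n \<in> carrier_vec m) \<Longrightarrow> \<psi> h = vec t (\<lambda>i. \<Sum>k\<le>N. (F k *\<^sub>v h (n + k)) $ i)"
    using assms(3) unfolding window_map_def by blast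
  have "\<phi> h @\<^sub>v \<psi> h = vec (s + t) (\<lambda>i. \<Sum>k\<le>N. ((G k @\<^sub>r F k) *\<^sub>v h (n + k)) $ i)"
    if h: "\<forall>n\<ge>n0. h n \<in> carrier_vec m" for h
  proof -
    have "((G k @\<^sub>r F k) *\<^sub>v h (n + k)) $ i
        = (if i < s then (G k *\<^sub>v h (n + k)) $ i else (F k *\<^sub>v h (n + k)) $ (i - s))"
      if "k \<le> N" "i < s + t" for k i
      using mat_mult_append[OF G F, of k k "h (n + k)"] G[of k] F[of k] that h n by simp
    then show ?thesis unfolding \<phi>[OF h] \<psi>[OF h] by (auto intro!: eq_vecI)
  qed
  moreover have "\<forall>k\<le>N. G k @\<^sub>r F k \<in> carrier_mat (s + t) m" using G F by auto
  ultimately show ?thesis unfolding window_map_def by (intro exI[of _ "\<lambda>k. G k @\<^sub>r F k"]) simp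
qed

definition subvec :: "nat \<Rightarrow> nat \<Rightarrow> 'a vec \<Rightarrow> 'a vec" where
  "subvec k l u = vec l (\<lambda>i. u $ (k + i))"

lemma subvec_carrier [simp]: "subvec k l u \<in> carrier_vec l"
  unfolding subvec_def by simp

lemma append_subvec: "subvec k l u @\<^sub>v subvec (k + l) l' u = subvec k (l + l') u"
  unfolding subvec_def by (intro eq_vecI) (auto simp: add.assoc)

lemma subvec_all: "u \<in> carrier_vec l \<Longrightarrow> subvec 0 l u = u"
  unfolding subvec_def by auto

lemma window_map_subvec:
  assumes n: "n \<ge> n0" and w: "window_map n0 m s N n \<phi>" and le: "a + t \<le> s"
  shows "window_map n0 m t N n (\<lambda>h. subvec a t (\<phi> h))"
proof -
  obtain G where G: "\<And>k. k \<le> N \<Longrightarrow> G k \<in> carrier_mat s m"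
    and \<phi>: "\<And>h. (\<forall>n\<ge>n0. h n \<in> carrier_vec m) \<Longrightarrow> \<phi> h = vec s (\<lambda>i. \<Sum>k\<le>N. (G k *\<^sub>v h (n + k)) $ i)"
    using w unfolding window_map_def by blast
  define G' where "G' k = mat t m (\<lambda>(i, j). G k $$ (a + i, j))" for k
  have "subvec a t (\<phi> h) = vec t (\<lambda>i. \<Sum>k\<le>N. (G' k *\<^sub>v h (n + k)) $ i)"
    if h: "\<forall>n\<ge>n0. h n \<in> carrier_vec m" for h
  proof -
    have "(G' k *\<^sub>v h (n + k)) $ i = (G k *\<^sub>v h (n + k)) $ (a + i)" if "k \<le> N" "i < t" for k i
    proof -
      have "row (G' k) i = row (G k) (a + i)"
        unfolding G'_def using G[OF that(1)] that(2) le by (intro eq_vecI) auto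
      then show ?thesis unfolding G'_def using G[OF that(1)] that(2) le by simp
    qed
    then show ?thesis unfolding \<phi>[OF h] subvec_def using le by (auto intro!: eq_vecI)
  qed
  moreover have "\<forall>k\<le>N. G' k \<in> carrier_mat t m" unfolding G'_def by simp
  ultimately show ?thesis unfolding window_map_def by blast
qed

text \<open>Choice over \<open>n\<close> joins the coefficients of the single times into one family,
  still independent of \<open>h\<close>.\<close>

lemma formed_from_window_if_window_map:
  assumes "\<And>n. n \<ge> n0 \<Longrightarrow> window_map n0 m s N n (\<lambda>h. T h n)"
  shows "\<exists>G. \<forall>h. (\<forall>n\<ge>n0. h n \<in> carrier_vec m) \<longrightarrow> formed_from_window n0 s m N G h (T h)"
proof -
  have "\<forall>n. \<exists>G. n \<ge> n0 \<longrightarrow> (\<forall>k\<le>N. G k \<in> carrier_mat s m) \<and>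
     (\<forall>h. (\<forall>n\<ge>n0. h n \<in> carrier_vec m) \<longrightarrow> T h n = vec s (\<lambda>i. \<Sum>k\<le>N. (G k *\<^sub>v h (n + k)) $ i))"
    using assms unfolding window_map_def by blast
  from choice[OF this] obtain G where "\<forall>n. n \<ge> n0 \<longrightarrow> (\<forall>k\<le>N. G n k \<in> carrier_mat s m) \<and>
     (\<forall>h. (\<forall>n\<ge>n0. h n \<in> carrier_vec m) \<longrightarrow> T h n = vec s (\<lambda>i. \<Sum>k\<le>N. (G n k *\<^sub>v h (n + k)) $ i))"
    by blast
  then show ?thesis unfolding formed_from_window_def by blast
qed

subsection \<open>Runs of the algorithm\<close>

text \<open>
  The data of the algorithm that depend on the inhomogeneity, recomputed for another
  inhomogeneity \<open>h\<close> with the same scalings and reduction matrices.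
\<close>

definition with_rhs :: "nat \<Rightarrow> condensed \<Rightarrow> (nat \<Rightarrow> real vec) \<Rightarrow> condensed" where
  "with_rhs m K h = K\<lparr>
     rhs1 := \<lambda>n. subvec 0 (size2 K n) (scaling K n *\<^sub>v h n),
     rhs2 := \<lambda>n. subvec (size2 K n) (size1 K n) (scaling K n *\<^sub>v h n),
     rhs3 := \<lambda>n. subvec (size2 K n + size1 K n) (size0 K n) (scaling K n *\<^sub>v h n),
     rhs4 := \<lambda>n. subvec (size2 K n + size1 K n + size0 K n) (sizev m K n) (scaling K n *\<^sub>v h n)\<rparr>"

primrec inhom_seq :: "nat \<Rightarrow> nat \<Rightarrow> (nat \<Rightarrow> condensed) \<Rightarrow> (nat \<Rightarrow> reduction) \<Rightarrow>
    (nat \<Rightarrow> real vec) \<Rightarrow> nat \<Rightarrow> nat \<Rightarrow> real vec" where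
  "inhom_seq m d K R h 0 = h"
| "inhom_seq m d K R h (Suc i) =
     inhom (reduced_side m d (with_rhs m (K i) (inhom_seq m d K R h i)) (R i))"

lemma with_rhs_simps [simp]:
  "blkA1 (with_rhs m K h) = blkA1 K" "blkB1 (with_rhs m K h) = blkB1 K"
  "blkC1 (with_rhs m K h) = blkC1 K" "blkB2 (with_rhs m K h) = blkB2 K"
  "blkC2 (with_rhs m K h) = blkC2 K" "blkC3 (with_rhs m K h) = blkC3 K"
  "scaling (with_rhs m K h) = scaling K" "size2 (with_rhs m K h) = size2 K"
  "size1 (with_rhs m K h) = size1 K" "size0 (with_rhs m K h) = size0 K"
  "sizev m' (with_rhs m K h) = sizev m' K"
  by (auto simp: with_rhs_def size2_def size1_def size0_def sizev_def fun_eq_iff)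

lemma rhs_with_rhs:
  "rhs1 (with_rhs m K h) n = subvec 0 (size2 K n) (scaling K n *\<^sub>v h n)"
  "rhs2 (with_rhs m K h) n = subvec (size2 K n) (size1 K n) (scaling K n *\<^sub>v h n)"
  "rhs3 (with_rhs m K h) n = subvec (size2 K n + size1 K n) (size0 K n) (scaling K n *\<^sub>v h n)"
  "rhs4 (with_rhs m K h) n
     = subvec (size2 K n + size1 K n + size0 K n) (sizev m K n) (scaling K n *\<^sub>v h n)"
  by (simp_all add: with_rhs_def)

lemma admissible_with_rhs:
  "admissible_reduction n0 d K R \<Longrightarrow> admissible_reduction n0 d (with_rhs m K h) R"
  unfolding admissible_reduction_def by simp

text \<open>This identifies a replayed system with the corresponding system of the run, up to the
  inhomogeneity.\<close>

lemma reduced_side_with_rhs: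
  "reduced_side m d (with_rhs m K h) R
     = (reduced_side m d K R)\<lparr>inhom := inhom (reduced_side m d (with_rhs m K h) R)\<rparr>"
  unfolding reduced_side_def by simp

text \<open>The coefficient blocks carry over with the scaling. The scaled \<open>h\<close> is cut
  at the block sizes, and since these add up to \<open>m\<close>, the pieces reassemble it.\<close>

lemma condensed_with_rhs:
  assumes E: "side_dims n0 m d E" and K: "is_condensed_form n0 m d E K"
    and h: "\<And>n. n \<ge> n0 \<Longrightarrow> h n \<in> carrier_vec m"
  shows "is_condensed_form n0 m d (E\<lparr>inhom := h\<rparr>) (with_rhs m K h)"
proof -
  have "scaling K n *\<^sub>v h n = rhs1 (with_rhs m K h) n @\<^sub>v rhs2 (with_rhs m K h) n
      @\<^sub>v rhs3 (with_rhs m K h) n @\<^sub>v rhs4 (with_rhs m K h) n" if n: "n \<ge> n0" for n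
  proof -
    have "scaling K n *\<^sub>v h n \<in> carrier_vec m"
      using condensed_coefs(4)[OF K n] h[OF n] by (rule mult_mat_vec_carrier)
    then have c: "scaling K n *\<^sub>v h n
        \<in> carrier_vec (size2 K n + (size1 K n + (size0 K n + sizev m K n)))"
      using condensed_form_dims(11)[OF E K n] by (simp add: add.assoc)
    show ?thesis
      unfolding rhs_with_rhs append_subvec
      using append_subvec[of 0 "size2 K n" "scaling K n *\<^sub>v h n"] subvec_all[OF c] by simp
  qed
  moreover have "rhs_dims n0 (size2 K) (size1 K) (size0 K) (sizev m K) (rhs1 (with_rhs m K h))
      (rhs2 (with_rhs m K h)) (rhs3 (with_rhs m K h)) (rhs4 (with_rhs m K h))"
    unfolding rhs_dims_def rhs_with_rhs by simp
  moreover have "blocks_dims n0 d (size2 K) (size1 K) (size0 K) (with_rhs m K h)"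
    using K unfolding is_condensed_form_def blocks_dims_def by simp
  ultimately show ?thesis
    using K unfolding is_condensed_form_def same_side_def scaled_side_def block_side_def by simp
qed

lemma window_map_rhs:
  assumes E: "side_dims n0 m d E" and K: "is_condensed_form n0 m d E K"
    and n: "n \<ge> n0" and w: "window_map n0 m m N n (\<lambda>h. T h n)"
  shows "window_map n0 m (size2 K n) N n (\<lambda>h. rhs1 (with_rhs m K (T h)) n)"
    "window_map n0 m (size1 K n) N n (\<lambda>h. rhs2 (with_rhs m K (T h)) n)"
    "window_map n0 m (size0 K n) N n (\<lambda>h. rhs3 (with_rhs m K (T h)) n)"
    "window_map n0 m (sizev m K n) N n (\<lambda>h. rhs4 (with_rhs m K (T h)) n)"
  unfolding rhs_with_rhs using condensed_form_dims(11)[OF E K n]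
  by (auto intro!: window_map_subvec[OF n window_map_mult[OF n condensed_coefs(4)[OF K n] w]])

text \<open>The furthest reach is that of \<open>rhs3\<close> at time \<open>n + 2\<close>, whose
  window ends at \<open>n + 2 + N\<close>. All terms are brought to this common window at
  \<open>n\<close>, as sums and concatenations require.\<close>

lemma window_map_reduced:
  assumes E: "side_dims n0 m d E" and K: "is_condensed_form n0 m d E K"
    and R: "admissible_reduction n0 d K R" and n: "n \<ge> n0"
    and w: "\<And>n. n \<ge> n0 \<Longrightarrow> window_map n0 m m N n (\<lambda>h. T h n)"
  shows "window_map n0 m m (N + 2) n (\<lambda>h. inhom (reduced_side m d (with_rhs m K (T h)) R) n)"
proof -
  note rhs = window_map_rhs[where T = T, OF E K _ w]
  note A = admissible_reductionD[OF R n]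
  have n0: "n \<ge> n0" and n1: "n + 1 \<ge> n0" and n2: "n + 2 \<ge> n0" using n by auto
  have shift: "window_map n0 m s (N + 2) n \<phi>" if "window_map n0 m s N (n + j) \<phi>" "j \<le> 2" for s j \<phi>
    using window_map_shift[OF n that(1)] that(2) by simp
  note s0 = shift[of _ 0, unfolded add_0_right] and s1 = shift[of _ 1] and s2 = shift[of _ 2]
  note mult = window_map_mult[OF n] and add = window_map_add[OF n] and app = window_map_append[OF n]
  have "window_map n0 m (dim_row (S2 R n) + (dim_row (Z2 R n) + (dim_row (S1 R n)
      + (dim_row (Z1 R n) + (size0 K n + sizev m K n))))) (N + 2) n
      (\<lambda>h. inhom (reduced_side m d (with_rhs m K (T h)) R) n)"
    unfolding reduced_side_def side.simps
    by (intro app add mult[OF A(1)] mult[OF A(2)] mult[OF A(3)] mult[OF A(4)] mult[OF A(5)]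
        mult[OF A(6)] mult[OF A(7)] s0[OF rhs(1)] s0[OF rhs(2)] s0[OF rhs(3)] s0[OF rhs(4)]
        s1[OF rhs(2)] s1[OF rhs(3)] s2[OF rhs(3)] n0 n1 n2) simp_all
  moreover have "dim_row (S2 R n) + (dim_row (Z2 R n) + (dim_row (S1 R n)
      + (dim_row (Z1 R n) + (size0 K n + sizev m K n)))) = m"
    using condensed_form_dims(11)[OF E K n] reduction_sizes[OF R n] by simp
  ultimately show ?thesis by simp
qed

lemma constant_sizev:
  assumes "constant_rank_assumption n0 K" "n \<ge> n0"
  shows "sizev m K n = sizev m K n0"
  using assms unfolding constant_rank_assumption_def sizev_def by auto

lemma side_dims_inhom:
  assumes "side_dims n0 m d E" "\<And>n. n \<ge> n0 \<Longrightarrow> h n \<in> carrier_vec m"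
  shows "side_dims n0 m d (E\<lparr>inhom := h\<rparr>)"
  using assms unfolding side_dims_def by simp

text \<open>The window part has a second use: it supplies the dimensions of the replayed right-hand
  sides, without which the solution sets could not be compared in the next step.\<close>

lemma run_invariant:
  assumes E: "side_dims n0 m d E" and run: "algorithm_run n0 m d E sys K R"
    and cr: "\<And>i. reached n0 K i \<Longrightarrow> constant_rank_assumption n0 (K i)"
    and i: "reached n0 K i"
  shows "side_dims n0 m d (sys i) \<and>
    (\<forall>n\<ge>n0. window_map n0 m m (2 * i) n (\<lambda>h. inhom_seq m d K R h i n)) \<and>
    (\<forall>h. (\<forall>n\<ge>n0. h n \<in> carrier_vec m) \<longrightarrow>
       solution_set n0 d (E\<lparr>inhom := h\<rparr>) = solution_set n0 d ((sys i)\<lparr>inhom := inhom_seq m d K R h i\<rparr>))"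
  using i
proof (induction i)
  case 0
  then show ?case using E run window_map_at unfolding algorithm_run_def by simp
next
  case (Suc i)
  have ri: "reached n0 K i" and ns: "\<not> stopping_condition n0 (K i)"
    using Suc.prems unfolding reached_def by auto
  have Ki: "is_condensed_form n0 m d (sys i) (K i)" and Ri: "admissible_reduction n0 d (K i) (R i)"
    and sys: "sys (Suc i) = reduced_side m d (K i) (R i)"
    using run ri ns unfolding algorithm_run_def by auto
  note IH = Suc.IH[OF ri]
  have dims: "side_dims n0 m d (sys i)" using IH by (rule conjunct1)
  have w: "window_map n0 m m (2 * i) n (\<lambda>h. inhom_seq m d K R h i n)" if "n \<ge> n0" for n
    using IH[THEN conjunct2, THEN conjunct1, rule_format, OF that] .
  note sol = IH[THEN conjunct2, THEN conjunct2, rule_format]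
  have sol': "solution_set n0 d (E\<lparr>inhom := h\<rparr>)
      = solution_set n0 d ((sys (Suc i))\<lparr>inhom := inhom_seq m d K R h (Suc i)\<rparr>)"
    if h: "\<forall>n\<ge>n0. h n \<in> carrier_vec m" for h
  proof -
    let ?h = "inhom_seq m d K R h i"
    have hi: "?h n \<in> carrier_vec m" if "n \<ge> n0" for n
      using window_map_carrier[OF w[OF that]] h by auto
    have "solution_set n0 d (reduced_side m d (with_rhs m (K i) ?h) (R i))
        = solution_set n0 d ((sys i)\<lparr>inhom := ?h\<rparr>)"
      by (rule solution_set_reduced[OF side_dims_inhom[OF dims hi] condensed_with_rhs[OF dims Ki hi]
            admissible_with_rhs[OF Ri]])
        (assumption, assumption, unfold with_rhs_simps, rule constant_sizev[OF cr[OF ri]])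
    moreover have "solution_set n0 d (E\<lparr>inhom := h\<rparr>) = solution_set n0 d ((sys i)\<lparr>inhom := ?h\<rparr>)"
      by (rule sol) (use h in simp)
    ultimately have "solution_set n0 d (E\<lparr>inhom := h\<rparr>)
        = solution_set n0 d (reduced_side m d (with_rhs m (K i) ?h) (R i))" by (rule trans[OF _ sym, rotated])
    also note arg_cong[OF reduced_side_with_rhs, of "solution_set n0 d"]
    finally show ?thesis unfolding sys inhom_seq.simps .
  qed
  have dims': "side_dims n0 m d (sys (Suc i))"
    unfolding sys using reduced_side_dims[OF dims Ki Ri] .
  have w': "window_map n0 m m (2 * Suc i) n (\<lambda>h. inhom_seq m d K R h (Suc i) n)"
    if "n \<ge> n0" for n
    using window_map_reduced[where N = "2 * i" and T = "\<lambda>h. inhom_seq m d K R h i",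
        OF dims Ki Ri that w] by simp
  show ?case using dims' w' sol' by (intro conjI allI impI)
qed

text \<open>An endless run would descend forever in the lexicographic order on pairs of sizes. The
  least stopping iteration is taken because \<open>reached\<close> forbids earlier ones.\<close>

lemma strangeness_index_exists:
  assumes E: "side_dims n0 m d E" and run: "algorithm_run n0 m d E sys K R"
    and cr: "\<And>i. reached n0 K i \<Longrightarrow> constant_rank_assumption n0 (K i)"
  shows "\<exists>\<mu>. is_strangeness_index n0 K \<mu>"
proof -
  have "\<exists>i. stopping_condition n0 (K i)"
  proof (rule ccontr)
    assume "\<nexists>i. stopping_condition n0 (K i)"
    then have ns: "\<not> stopping_condition n0 (K i)" and reached: "reached n0 K i" for i
      unfolding reached_def by auto
    have K: "is_condensed_form n0 m d (sys i) (K i)"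
      and R: "admissible_reduction n0 d (K i) (R i)"
      and sys: "sys (Suc i) = reduced_side m d (K i) (R i)" for i
      using run ns[of i] reached[of i] unfolding algorithm_run_def by auto
    have dims: "side_dims n0 m d (sys i)" for i
      using run_invariant[OF E run cr reached] by blast
    let ?f = "\<lambda>i. (size2 (K i) n0, size1 (K i) n0)"
    have dec: "(?f (Suc i), ?f i) \<in> less_than <*lex*> less_than" for i
      using size_decreases[OF dims K cr[OF reached] ns R K[of "Suc i", unfolded sys] cr[OF reached]]
      by auto
    have "\<exists>f. \<forall>i. (f (Suc i), f i) \<in> less_than <*lex*> less_than"
      by (rule exI[of _ ?f]) (rule allI, rule dec)
    then show False
      using wf_lex_prod[OF wf_less_than wf_less_than] unfolding wf_iff_no_infinite_down_chain by blast
  qed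
  then obtain \<mu> where "stopping_condition n0 (K \<mu>)" "\<And>j. j < \<mu> \<Longrightarrow> \<not> stopping_condition n0 (K j)"
    using exists_least_iff[of "\<lambda>i. stopping_condition n0 (K i)"] by blast
  then show ?thesis unfolding is_strangeness_index_def reached_def by blast
qed

text \<open>The first redundancy condition at \<open>n\<close> splits off \<open>blkA1 K n\<close>,
  and the second one at \<open>n + 1\<close> splits the remaining pair. The three full row ranks
  then add up to the number of rows.\<close>

lemma stopping_full_row_rank:
  assumes E: "side_dims n0 m d E" and K: "is_condensed_form n0 m d E K"
    and stop: "stopping_condition n0 K" and n: "n \<ge> n0"
  shows "full_row_rank (blkA1 K n @\<^sub>r blkB2 K (n + 1) @\<^sub>r blkC3 K (n + 2))"
proof -
  have n1: "n + 1 \<ge> n0" and n2: "n + 2 \<ge> n0" using n by auto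
  have "mrank (blkA1 K n @\<^sub>r blkB2 K (n + 1) @\<^sub>r blkC3 K (n + 2))
      = mrank (blkA1 K n) + mrank (blkB2 K (n + 1) @\<^sub>r blkC3 K (n + 2))"
    using stop n unfolding stopping_condition_def no_hidden_redundancy_def by blast
  \<comment> \<open>The condition at time \<open>n + 1\<close> yields the index
    \<open>n + 1 + 1\<close>; the fact that enters the chain is its simplified form with
    \<open>n + 2\<close>.\<close>
  also have "mrank (blkB2 K (n + 1) @\<^sub>r blkC3 K (n + 1 + 1))
      = mrank (blkB2 K (n + 1)) + mrank (blkC3 K (n + 1 + 1))"
    using stop n1 unfolding stopping_condition_def no_hidden_redundancy_def by blast
  then have "mrank (blkB2 K (n + 1) @\<^sub>r blkC3 K (n + 2))
      = mrank (blkB2 K (n + 1)) + mrank (blkC3 K (n + 2))" by simp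
  finally show ?thesis
    using condensed_coefs(5)[OF K n] condensed_coefs(6)[OF K n1] condensed_coefs(7)[OF K n2]
    unfolding full_row_rank_def append_rows_def by simp
qed

text \<open>The system already has the required form, so the identity serves as scaling; what
  remains is that all dimensions fit, so that it acts trivially.\<close>

lemma strangeness_free_block_side:
  assumes K: "blocks_dims n0 d (\<lambda>_. r2) (\<lambda>_. r1) (\<lambda>_. r0) (K :: blocks)"
    and g: "rhs_dims n0 (\<lambda>_. r2) (\<lambda>_. r1) (\<lambda>_. r0) (\<lambda>_. v) g1 g2 g3 g4"
    and m: "r2 + r1 + r0 + v = m"
    and full: "\<And>n. n \<ge> n0 \<Longrightarrow> full_row_rank (blkA1 K n @\<^sub>r blkB2 K (n + 1) @\<^sub>r blkC3 K (n + 2))"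
  shows "strangeness_free n0 m d (block_side d (\<lambda>_. v) K g1 g2 g3 g4)"
proof -
  let ?E = "block_side d (\<lambda>_. v) K g1 g2 g3 g4"
  have m': "r2 + (r1 + (r0 + v)) = m" using m by simp
  have "same_side n0 (scaled_side (\<lambda>_. 1\<^sub>m m) ?E) ?E"
    unfolding same_side_def
  proof (intro allI impI)
    fix n assume n: "n \<ge> n0"
    have B: "blkA1 K n \<in> carrier_mat r2 d" "blkB1 K n \<in> carrier_mat r2 d" "blkC1 K n \<in> carrier_mat r2 d"
      "blkB2 K n \<in> carrier_mat r1 d" "blkC2 K n \<in> carrier_mat r1 d" "blkC3 K n \<in> carrier_mat r0 d"
      using K n unfolding blocks_dims_def by auto
    have G: "g1 n \<in> carrier_vec r2" "g2 n \<in> carrier_vec r1" "g3 n \<in> carrier_vec r0" "g4 n \<in> carrier_vec v"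
      using g n unfolding rhs_dims_def by auto
    have "coefA ?E n \<in> carrier_mat m d" "coefB ?E n \<in> carrier_mat m d" "coefC ?E n \<in> carrier_mat m d"
      unfolding m'[symmetric] block_side_def side.simps size_eqs[OF K n]
      by (intro carrier_append_rows B zero_carrier_mat)+
    moreover have "inhom ?E n \<in> carrier_vec m"
      unfolding m'[symmetric] block_side_def side.simps by (intro append_carrier_vec G)
    ultimately show "coefA (scaled_side (\<lambda>_. 1\<^sub>m m) ?E) n = coefA ?E n \<and>
        coefB (scaled_side (\<lambda>_. 1\<^sub>m m) ?E) n = coefB ?E n \<and>
        coefC (scaled_side (\<lambda>_. 1\<^sub>m m) ?E) n = coefC ?E n \<and>
        inhom (scaled_side (\<lambda>_. 1\<^sub>m m) ?E) n = inhom ?E n"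
      unfolding scaled_side_def by simp
  qed
  moreover have "nonsingular m (1\<^sub>m m)"
    unfolding nonsingular_def invertible_mat_def inverts_mat_def by (auto intro: exI[of _ "1\<^sub>m m"])
  ultimately show ?thesis
    unfolding strangeness_free_def using K g full
    by (intro exI[of _ "\<lambda>_. 1\<^sub>m m"] exI[of _ r2] exI[of _ r1] exI[of _ r0] exI[of _ v] exI[of _ K]
        exI[of _ g1] exI[of _ g2] exI[of _ g3] exI[of _ g4] conjI allI impI)
qed

text \<open>\<open>H\<close>, \<open>G2\<close> and \<open>G3\<close> precede \<open>h\<close>
  because they come from the matrices of the run alone. The given equation is the case
  \<open>h = f\<close>.\<close>

theorem theorem3p8:
  fixes A B C :: "nat \<Rightarrow> real mat" and f :: "nat \<Rightarrow> real vec" and n0 m d :: nat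
    and sys :: "nat \<Rightarrow> side" and K :: "nat \<Rightarrow> condensed" and R :: "nat \<Rightarrow> reduction"
  assumes "side_dims n0 m d \<lparr>coefA = A, coefB = B, coefC = C, inhom = f\<rparr>"
    and "algorithm_run n0 m d \<lparr>coefA = A, coefB = B, coefC = C, inhom = f\<rparr> sys K R"
    and "\<And>i. reached n0 K i \<Longrightarrow> constant_rank_assumption n0 (K i)"
  shows "\<exists>\<mu>. is_strangeness_index n0 K \<mu> \<and>
    (let r2 = size2 (K \<mu>) n0; r1 = size1 (K \<mu>) n0; r0 = size0 (K \<mu>) n0; v = sizev m (K \<mu>) n0 in
     \<exists>(H :: blocks) G2 G3.
       blocks_dims n0 d (\<lambda>_. r2) (\<lambda>_. r1) (\<lambda>_. r0) H \<and>
       (\<forall>n\<ge>n0. full_row_rank (blkA1 H n @\<^sub>r blkB2 H (n + 1) @\<^sub>r blkC3 H (n + 2))) \<and>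
       (\<forall>h. (\<forall>n\<ge>n0. h n \<in> carrier_vec m) \<longrightarrow>
          (\<exists>g1 g2 g3 g4.
             rhs_dims n0 (\<lambda>_. r2) (\<lambda>_. r1) (\<lambda>_. r0) (\<lambda>_. v) g1 g2 g3 g4 \<and>
             strangeness_free n0 m d (block_side d (\<lambda>_. v) H g1 g2 g3 g4) \<and>
             formed_from_window n0 r1 m (2 * \<mu>) G2 h g2 \<and>
             formed_from_window n0 r0 m (2 * \<mu>) G3 h g3 \<and>
             solution_set n0 d \<lparr>coefA = A, coefB = B, coefC = C, inhom = h\<rparr> =
             solution_set n0 d (block_side d (\<lambda>_. v) H g1 g2 g3 g4))))"
proof -
  note E = assms(1) and run = assms(2) and cr = assms(3)
  obtain \<mu> where \<mu>: "is_strangeness_index n0 K \<mu>"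
    using strangeness_index_exists[OF E run cr] by blast
  then have reached: "reached n0 K \<mu>" and stop: "stopping_condition n0 (K \<mu>)"
    unfolding is_strangeness_index_def by auto
  define r2 r1 r0 v where r: "r2 = size2 (K \<mu>) n0" "r1 = size1 (K \<mu>) n0" "r0 = size0 (K \<mu>) n0"
    "v = sizev m (K \<mu>) n0"
  have const: "size2 (K \<mu>) n = r2" "size1 (K \<mu>) n = r1" "size0 (K \<mu>) n = r0" "sizev m (K \<mu>) n = v"
    if "n \<ge> n0" for n
    using cr[OF reached] that unfolding constant_rank_assumption_def r sizev_def by auto
  have K\<mu>: "is_condensed_form n0 m d (sys \<mu>) (K \<mu>)"
    using run reached unfolding algorithm_run_def by blast
  let ?hs = "\<lambda>h. inhom_seq m d K R h \<mu>"
  note invariant = run_invariant[OF E run cr reached]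
  have dims: "side_dims n0 m d (sys \<mu>)" using invariant by blast
  have w: "window_map n0 m m (2 * \<mu>) n (\<lambda>h. ?hs h n)" if "n \<ge> n0" for n
    using invariant that by blast
  have sol: "solution_set n0 d \<lparr>coefA = A, coefB = B, coefC = C, inhom = h\<rparr>
      = solution_set n0 d ((sys \<mu>)\<lparr>inhom := ?hs h\<rparr>)" if "\<forall>n\<ge>n0. h n \<in> carrier_vec m" for h
    using invariant[THEN conjunct2, THEN conjunct2] that by simp
  have m: "r2 + r1 + r0 + v = m"
    using condensed_form_dims(11)[OF dims K\<mu>, of n0] r by simp
  \<comment> \<open>The condensed form is cut down to its blocks, since strangeness-freeness
    quantifies over the bare record type \<open>blocks\<close>.\<close>
  define H :: blocks where "H = \<lparr>blkA1 = blkA1 (K \<mu>), blkB1 = blkB1 (K \<mu>), blkC1 = blkC1 (K \<mu>),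
    blkB2 = blkB2 (K \<mu>), blkC2 = blkC2 (K \<mu>), blkC3 = blkC3 (K \<mu>)\<rparr>"
  have H: "blocks_dims n0 d (\<lambda>_. r2) (\<lambda>_. r1) (\<lambda>_. r0) H"
    using K\<mu> const unfolding is_condensed_form_def blocks_dims_def H_def by simp
  have full: "full_row_rank (blkA1 H n @\<^sub>r blkB2 H (n + 1) @\<^sub>r blkC3 H (n + 2))" if "n \<ge> n0" for n
    using stopping_full_row_rank[OF dims K\<mu> stop that] unfolding H_def by simp
  let ?K = "\<lambda>h. with_rhs m (K \<mu>) (?hs h)"
  have "window_map n0 m r1 (2 * \<mu>) n (\<lambda>h. rhs2 (?K h) n)" if "n \<ge> n0" for n
    using window_map_rhs(2)[where T = ?hs, OF dims K\<mu> that w[OF that]] const[OF that] by simp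
  \<comment> \<open>The coefficients belong to the map sending \<open>h\<close> to its replayed
    middle block, so they are fixed before any \<open>h\<close> is.\<close>
  from formed_from_window_if_window_map[of n0 m r1 "2 * \<mu>" "\<lambda>h. rhs2 (?K h)", OF this]
  obtain G2 where G2: "\<forall>h. (\<forall>n\<ge>n0. h n \<in> carrier_vec m) \<longrightarrow>
      formed_from_window n0 r1 m (2 * \<mu>) G2 h (rhs2 (?K h))" ..
  have "window_map n0 m r0 (2 * \<mu>) n (\<lambda>h. rhs3 (?K h) n)" if "n \<ge> n0" for n
    using window_map_rhs(3)[where T = ?hs, OF dims K\<mu> that w[OF that]] const[OF that] by simp
  from formed_from_window_if_window_map[of n0 m r0 "2 * \<mu>" "\<lambda>h. rhs3 (?K h)", OF this]
  obtain G3 where G3: "\<forall>h. (\<forall>n\<ge>n0. h n \<in> carrier_vec m) \<longrightarrow>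
      formed_from_window n0 r0 m (2 * \<mu>) G3 h (rhs3 (?K h))" ..
  have claim: "rhs_dims n0 (\<lambda>_. r2) (\<lambda>_. r1) (\<lambda>_. r0) (\<lambda>_. v) (rhs1 (?K h)) (rhs2 (?K h)) (rhs3 (?K h)) (rhs4 (?K h)) \<and>
      strangeness_free n0 m d (block_side d (\<lambda>_. v) H (rhs1 (?K h)) (rhs2 (?K h)) (rhs3 (?K h)) (rhs4 (?K h))) \<and>
      formed_from_window n0 r1 m (2 * \<mu>) G2 h (rhs2 (?K h)) \<and>
      formed_from_window n0 r0 m (2 * \<mu>) G3 h (rhs3 (?K h)) \<and>
      solution_set n0 d \<lparr>coefA = A, coefB = B, coefC = C, inhom = h\<rparr> =
      solution_set n0 d (block_side d (\<lambda>_. v) H (rhs1 (?K h)) (rhs2 (?K h)) (rhs3 (?K h)) (rhs4 (?K h)))"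
    if h: "\<forall>n\<ge>n0. h n \<in> carrier_vec m" for h
  proof -
    have hs: "?hs h n \<in> carrier_vec m" if "n \<ge> n0" for n
      using window_map_carrier[OF w[OF that]] h by auto
    have g: "rhs_dims n0 (\<lambda>_. r2) (\<lambda>_. r1) (\<lambda>_. r0) (\<lambda>_. v) (rhs1 (?K h)) (rhs2 (?K h)) (rhs3 (?K h)) (rhs4 (?K h))"
      unfolding rhs_dims_def rhs_with_rhs using const by simp
    have "solution_set n0 d ((sys \<mu>)\<lparr>inhom := ?hs h\<rparr>)
        = staircase_solutions n0 d (?K h) (rhs1 (?K h)) (rhs2 (?K h)) (rhs3 (?K h)) (rhs4 (?K h)) v"
      by (rule solution_set_condensed[OF side_dims_inhom[OF dims hs] condensed_with_rhs[OF dims K\<mu> hs]])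
        (use const in simp_all)
    also have "\<dots> = staircase_solutions n0 d H (rhs1 (?K h)) (rhs2 (?K h)) (rhs3 (?K h)) (rhs4 (?K h)) v"
      unfolding staircase_solutions_def H_def by simp
    also have "\<dots> = solution_set n0 d (block_side d (\<lambda>_. v) H (rhs1 (?K h)) (rhs2 (?K h)) (rhs3 (?K h)) (rhs4 (?K h)))"
      by (rule solution_set_block_side[OF H g refl, symmetric])
    finally show ?thesis
      using g strangeness_free_block_side[OF H g m full] G2 G3 h sol[OF h] by simp
  qed
  show ?thesis
    apply (rule exI[of _ \<mu>], rule conjI[OF \<mu>])
    unfolding Let_def r[symmetric]
    by (rule exI[of _ H], rule exI[of _ G2], rule exI[of _ G3], intro conjI allI impI)
      (rule H, rule full, assumption, (rule exI)+, rule claim, assumption)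
qed

end
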